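(* Let $\mathbb{K}\in\{\mathbb{R},\mathbb{C}\}$ and let $f\in\mathbb{K}[x_1,\ldots,x_n]$ be a homogeneous polynomial of degree 3. Consider the following randomized procedure: (1) Pick a matrix $R=(r_{ij})\in M_n(\mathbb{K})$ and set $h(x)=f(Rx)$. (2) Let $T_1,\ldots,T_n$ be the slices of $h$. If $T_1$ is singular, reject. Otherwise compute $T_1'=T_1^{-1}$. (3) If the matrices $T_1'T_k$ ($k=2,\ldots,n$) pairwise commute and are all diagonalizable over $\mathbb{K}$, accept; otherwise reject. Then: if $f$ is accepted by some run of this procedure (for some choice of $R$), $f$ is equivalent over $\mathbb{K}$ to a sum of $n$ cubes. Conversely, if $f$ is equivalent over $\mathbb{K}$ to a sum of $n$ cubes and the entries $r_{ij}$ of $R$ are chosen independently at random from a finite set $S\subseteq\mathbb{K}$, then $f$ is accepted with probability at least $1-2n/|S|$.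
   Context: A homogeneous polynomial $f\in\mathbb{K}[x_1,\ldots,x_n]$ of degree 3 is equivalent (over $\mathbb{K}$) to a sum of $n$ cubes if $f(x)=P_3(Ax)$ for some nonsingular $A\in M_n(\mathbb{K})$, where $P_3(x_1,\ldots,x_n)=x_1^3+\cdots+x_n^3$. The slices of a degree 3 form $g$ are defined as follows: let $T_{ijk}=\frac16\,\partial^3 g/\partial x_i\partial x_j\partial x_k$ (the symmetric tensor with $g=\sum_{i,j,k}T_{ijk}x_ix_jx_k$); the $i$-th slice of $g$ is the symmetric $n\times n$ matrix $T_i$ with entries $(T_i)_{jk}=T_{ijk}$. *)

theory Defs
  imports
    "HOL-Library.Poly_Mapping"
    "HOL-Probability.Product_PMF"
    "Jordan_Normal_Form.Gauss_Jordan_Elimination"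
begin

(* Polynomials in variables indexed by the natural numbers: a finitely supported map from
   exponent vectors to coefficients, with the convolution product of Poly_Mapping.
   The variables x_1, ..., x_n are numbered 0, ..., n - 1, like the rows and columns of
   a matrix. *)
type_synonym 'a mpoly = "(nat \<Rightarrow>\<^sub>0 nat) \<Rightarrow>\<^sub>0 'a"

definition const :: "'a::zero \<Rightarrow> 'a mpoly" where
  "const c = Poly_Mapping.single 0 c"

definition var :: "nat \<Rightarrow> 'a::zero_neq_one mpoly" where
  "var i = Poly_Mapping.single (Poly_Mapping.single i 1) 1"

definition in_vars :: "nat \<Rightarrow> 'a::zero mpoly \<Rightarrow> bool" where
  "in_vars n p \<longleftrightarrow> (\<forall>m \<in> Poly_Mapping.keys p. Poly_Mapping.keys m \<subseteq> {..<n})"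

(* As usual, the zero polynomial is homogeneous of every degree. *)
definition homogeneous :: "nat \<Rightarrow> 'a::zero mpoly \<Rightarrow> bool" where
  "homogeneous d p \<longleftrightarrow>
     (\<forall>m \<in> Poly_Mapping.keys p. (\<Sum>i \<in> Poly_Mapping.keys m. Poly_Mapping.lookup m i) = d)"

definition subst_vars :: "(nat \<Rightarrow> 'a::comm_ring_1 mpoly) \<Rightarrow> 'a mpoly \<Rightarrow> 'a mpoly" where
  "subst_vars s p =
     (\<Sum>m \<in> Poly_Mapping.keys p. const (Poly_Mapping.lookup p m) *
        (\<Prod>i \<in> Poly_Mapping.keys m. s i ^ Poly_Mapping.lookup m i))"

(* p(A x); meant for p in the variables below n and A an n-by-n matrix. *)
definition lin_subst :: "'a::comm_ring_1 mpoly \<Rightarrow> 'a mat \<Rightarrow> 'a mpoly" where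
  "lin_subst p A = subst_vars (\<lambda>i. \<Sum>j<dim_col A. const (A $$ (i, j)) * var j) p"

(* For exponent vectors m with m_i = 0, where the subtraction is truncated, the coefficient
   is zero. *)
definition partial_deriv :: "nat \<Rightarrow> 'a::comm_ring_1 mpoly \<Rightarrow> 'a mpoly" where
  "partial_deriv i p =
     (\<Sum>m \<in> Poly_Mapping.keys p.
        Poly_Mapping.single (m - Poly_Mapping.single i 1)
          (of_nat (Poly_Mapping.lookup m i) * Poly_Mapping.lookup p m))"

definition sum_cubes :: "nat \<Rightarrow> 'a::comm_ring_1 mpoly" where
  "sum_cubes n = (\<Sum>i<n. var i ^ 3)"

definition equiv_sum_cubes :: "nat \<Rightarrow> 'a::field_char_0 mpoly \<Rightarrow> bool" where
  "equiv_sum_cubes n f \<longleftrightarrow>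
     (\<exists>A \<in> carrier_mat n n. invertible_mat A \<and> f = lin_subst (sum_cubes n) A)"

(* The third partial derivatives of a cubic form are constants, read off here as the
   coefficient of the monomial 1. *)
definition slice :: "nat \<Rightarrow> 'a::field_char_0 mpoly \<Rightarrow> nat \<Rightarrow> 'a mat" where
  "slice n g i = Matrix.mat n n (\<lambda>(j, k).
     Poly_Mapping.lookup (partial_deriv i (partial_deriv j (partial_deriv k g))) 0 / 6)"

(* The diagonalizing matrix has entries in the type 'a, so this is diagonalizability over 'a. *)
definition diagonalizable :: "'a::field mat \<Rightarrow> bool" where
  "diagonalizable M \<longleftrightarrow> (\<exists>D. diagonal_mat D \<and> similar_mat M D)"

(* One run of the procedure on f with the matrix R; the slices T_1, ..., T_n are
   T 0, ..., T (n - 1), and mat_inverse is only used on an invertible matrix. *)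
definition accepts :: "nat \<Rightarrow> 'a::field_char_0 mpoly \<Rightarrow> 'a mat \<Rightarrow> bool" where
  "accepts n f R \<longleftrightarrow>
     (let h = lin_subst f R;
          T = slice n h;
          T' = the (mat_inverse (T 0))
      in invertible_mat (T 0) \<and>
         (\<forall>k \<in> {1..<n}. \<forall>l \<in> {1..<n}. (T' * T k) * (T' * T l) = (T' * T l) * (T' * T k)) \<and>
         (\<forall>k \<in> {1..<n}. diagonalizable (T' * T k)))"

(* The n-by-n matrix with independent entries, each uniformly distributed on S. *)
definition random_mat :: "nat \<Rightarrow> 'a::zero set \<Rightarrow> 'a mat pmf" where
  "random_mat n S =
     map_pmf (Matrix.mat n n) (Pi_pmf ({..<n} \<times> {..<n}) 0 (\<lambda>_. pmf_of_set S))"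

end

theory Submission
  imports Defs "Jordan_Normal_Form.Determinant"
begin

text \<open>
  Let \<open>T\<^sub>k\<close> be the slices of \<open>h(x) = f(R x)\<close>, numbered from 0. If the matrices \<open>T\<^sub>0\<inverse> T\<^sub>k\<close> commute and
  are diagonalizable, then \<open>T\<^sub>0\<inverse> T\<^sub>k = P D\<^sub>k P\<inverse>\<close> with one matrix \<open>P\<close> for all \<open>k\<close>; put \<open>S = T\<^sub>0 P\<close>
  and \<open>Q = P\<inverse>\<close>, so that \<open>T\<^sub>k = S D\<^sub>k Q\<close>. Exchanging the slice index with the column index
  forces \<open>D\<^sub>k\<close> to have the diagonal entries \<open>Q\<^sub>s\<^sub>k / Q\<^sub>s\<^sub>0\<close>, and the symmetry of the slices then forces
  \<open>S\<close> to be the transpose of \<open>Q\<close> up to scaling of its columns. So \<open>h\<close> is a combination of the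
  cubes of the rows of \<open>Q\<close>, whose coefficients are absorbed by cube roots. Since \<open>T\<^sub>0\<close> is a
  multiple of the transpose of \<open>R\<close>, its invertibility forces \<open>R\<close> to be invertible, and the substitution can
  be undone.

  Conversely, if \<open>f(x) = P\<^sub>3(A x)\<close> and \<open>B = A R\<close>, then \<open>T\<^sub>k = B\<^sup>T diag(B\<^sub>s\<^sub>k) B\<close>, so \<open>f\<close> is accepted
  unless \<open>det R = 0\<close> or one of the \<open>n\<close> linear forms \<open>B\<^sub>s\<^sub>0\<close> vanishes. Each linear form vanishes
  with probability at most \<open>1/|S|\<close>. With the same bound, the leading minor of order \<open>k + 1\<close> of \<open>R\<close> vanishes
  while the one of order \<open>k\<close> does not, as it is then affine and nonconstant in the corner entry.
\<close>

section \<open>Simultaneous diagonalization\<close>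

lemma det_nonzero_if_right_inverse:
  fixes A :: "'a::field mat"
  assumes "A \<in> carrier_mat n n" "B \<in> carrier_mat n n" "A * B = 1\<^sub>m n"
  shows "Determinant.det A \<noteq> 0"
  using det_mult [OF assms(1,2)] assms(3) by auto

lemma inverse_if_det_nonzero:
  fixes A :: "'a::field mat"
  assumes A: "A \<in> carrier_mat n n" and det: "Determinant.det A \<noteq> 0"
  obtains B where "B \<in> carrier_mat n n" "A * B = 1\<^sub>m n" "B * A = 1\<^sub>m n"
proof
  let ?B = "inverse (Determinant.det A) \<cdot>\<^sub>m adj_mat A"
  show "?B \<in> carrier_mat n n" using adj_mat(1) [OF A] by simp
  show "A * ?B = 1\<^sub>m n" "?B * A = 1\<^sub>m n"
    using adj_mat [OF A] A det by (auto simp: mult_smult_distrib mult_smult_assoc_mat intro!: eq_matI)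
qed

lemma invertible_mat_iff_det:
  fixes A :: "'a::field mat"
  assumes A: "A \<in> carrier_mat n n"
  shows "invertible_mat A \<longleftrightarrow> Determinant.det A \<noteq> 0"
proof
  assume "invertible_mat A"
  then obtain B where B: "A * B = 1\<^sub>m (dim_row A)" "B * A = 1\<^sub>m (dim_row B)"
    unfolding invertible_mat_def inverts_mat_def by auto
  have "dim_col B = n" using arg_cong [OF B(1), of dim_col] A by simp
  moreover have "dim_row B = n" using arg_cong [OF B(2), of dim_col] A by simp
  ultimately show "Determinant.det A \<noteq> 0"
    using A B(1) by (intro det_nonzero_if_right_inverse [of A n B]) auto
next
  assume "Determinant.det A \<noteq> 0"
  then obtain B where "B \<in> carrier_mat n n" "A * B = 1\<^sub>m n" "B * A = 1\<^sub>m n"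
    using inverse_if_det_nonzero [OF A] by blast
  then show "invertible_mat A"
    using A unfolding invertible_mat_def inverts_mat_def by (auto simp: square_mat.simps)
qed

lemma square_mult_carrier:
  "A \<in> carrier_mat n n \<Longrightarrow> B \<in> carrier_mat n n \<Longrightarrow> A * B \<in> carrier_mat n n"
  by (rule mult_carrier_mat)

lemma square_mult_assoc:
  fixes A :: "'a::field mat"
  assumes "A \<in> carrier_mat n n" "B \<in> carrier_mat n n" "C \<in> carrier_mat n n"
  shows "A * B * C = A * (B * C)"
  using assms by (rule assoc_mult_mat)

lemma square_mult_vec_assoc:
  fixes A :: "'a::field mat"
  assumes "A \<in> carrier_mat n n" "B \<in> carrier_mat n n" "v \<in> carrier_vec n"
  shows "A * B *\<^sub>v v = A *\<^sub>v (B *\<^sub>v v)"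
  using assms by (rule assoc_mult_mat_vec)

lemma inverse_mult_cancel:
  fixes A :: "'a::field mat"
  assumes "A * B = 1\<^sub>m n" "A \<in> carrier_mat n n" "B \<in> carrier_mat n n" "C \<in> carrier_mat n n"
  shows "A * (B * C) = C"
  using assms assoc_mult_mat [of A n n B n C n] by simp

lemmas square_simps = square_mult_carrier square_mult_assoc

lemma index_mult_mat_sum:
  assumes "A \<in> carrier_mat n m" "B \<in> carrier_mat m p" "i < n" "j < p"
  shows "(A * B) $$ (i, j) = (\<Sum>k<m. A $$ (i, k) * B $$ (k, j))"
  using assms by (simp add: scalar_prod_def atLeast0LessThan)

text \<open>Used to compare coefficients: combinations of independent columns agree only if their
  coefficients do. The coefficients form a function \<open>u\<close> on indices, since they arise as
  expressions in the entries of several matrices.\<close>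

lemma kernel_trivial_if_left_inverse:
  fixes S :: "'a::field mat"
  assumes S: "S \<in> carrier_mat n n" and S': "S' \<in> carrier_mat n n" and inv: "S' * S = 1\<^sub>m n"
    and zero: "\<And>i. i < n \<Longrightarrow> (\<Sum>s<n. S $$ (i, s) * u s) = 0" and t: "t < n"
  shows "u t = 0"
proof -
  have "u t = (\<Sum>s<n. (S' * S) $$ (t, s) * u s)"
    using t by (simp add: inv if_distrib [of "\<lambda>x. x * _"] cong: if_cong)
  also have "\<dots> = (\<Sum>s<n. \<Sum>i<n. S' $$ (t, i) * (S $$ (i, s) * u s))"
    using t by (intro sum.cong refl)
      (simp add: index_mult_mat_sum [OF S' S] sum_distrib_right mult.assoc del: index_mult_mat)
  also have "\<dots> = (\<Sum>i<n. S' $$ (t, i) * (\<Sum>s<n. S $$ (i, s) * u s))"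
    unfolding sum_distrib_left by (rule sum.swap)
  also have "\<dots> = 0" using zero by simp
  finally show ?thesis .
qed

text \<open>If no nonzero linear functional vanishes on \<open>V\<close>, then \<open>V\<close>
  spans and so contains a basis. The basis is built by exchange: starting from the identity matrix,
  column \<open>k\<close> is replaced by an element of \<open>V\<close> whose coordinate along that
  column is nonzero.\<close>

lemma invertible_columns_from_separating_set:
  fixes V :: "'a::field vec set"
  assumes V: "V \<subseteq> carrier_vec n"
    and sep: "\<And>y. y \<in> carrier_vec n \<Longrightarrow> y \<noteq> 0\<^sub>v n \<Longrightarrow> \<exists>v\<in>V. scalar_prod y v \<noteq> 0"
  shows "\<exists>P\<in>carrier_mat n n. Determinant.det P \<noteq> 0 \<and> (\<forall>j<n. col P j \<in> V)"
proof -
  have "\<exists>P\<in>carrier_mat n n. Determinant.det P \<noteq> 0 \<and> (\<forall>j<k. col P j \<in> V)" if "k \<le> n" for k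
    using that
  proof (induction k)
    case 0
    show ?case by (intro bexI [of _ "1\<^sub>m n"]) auto
  next
    case (Suc k)
    then obtain P where P: "P \<in> carrier_mat n n" "Determinant.det P \<noteq> 0" "\<forall>j<k. col P j \<in> V"
      by auto
    obtain P' where P': "P' \<in> carrier_mat n n" "P * P' = 1\<^sub>m n" "P' * P = 1\<^sub>m n"
      using inverse_if_det_nonzero [OF P(1,2)] .
    have k: "k < n" using Suc.prems by simp
    \<comment> \<open>Row \<open>k\<close> of the inverse \<open>P'\<close> is the functional that
      reads off the coordinate along column \<open>k\<close> of \<open>P\<close>. It takes the value
      1 on that column, so it is nonzero.\<close>
    have "(P' * P) $$ (k, k) = scalar_prod (Matrix.row P' k) (col P k)"
      using P(1) P'(1) k by simp
    with P'(3) k have "scalar_prod (Matrix.row P' k) (col P k) = 1" by simp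
    then have "Matrix.row P' k \<noteq> 0\<^sub>v n" using P(1) by auto
    then obtain v where v: "v \<in> V" "scalar_prod (Matrix.row P' k) v \<noteq> 0"
      using sep [of "Matrix.row P' k"] P'(1) k by auto
    have vn: "v \<in> carrier_vec n" using v V by auto
    have x: "P' *\<^sub>v v \<in> carrier_vec n" using P'(1) vn by simp
    have "P *\<^sub>v (P' *\<^sub>v v) = v"
      using P(1) P' vn by (metis assoc_mult_mat_vec one_mult_mat_vec)
    \<comment> \<open>By Cramer's rule, putting \<open>v\<close> into column \<open>k\<close>
      multiplies the determinant by coordinate \<open>k\<close> of
      \<open>P' *\<^sub>v v\<close>.\<close>
    with cramer_lemma_mat [OF P(1) x k]
    have "Determinant.det (replace_col P v k) = (P' *\<^sub>v v) $ k * Determinant.det P" by simp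
    then have "Determinant.det (replace_col P v k) \<noteq> 0"
      using P(2) v(2) P'(1) k by simp
    moreover have "col (replace_col P v k) j \<in> V" if "j < Suc k" for j
    proof (cases "j = k")
      case True
      then have "col (replace_col P v k) j = v"
        using P(1) vn k by (intro eq_vecI) (auto simp: replace_col_def)
      with v show ?thesis by simp
    next
      case False
      then have "col (replace_col P v k) j = col P j"
        using P(1) k that by (intro eq_vecI) (auto simp: replace_col_def)
      with P(3) False that show ?thesis by simp
    qed
    moreover have "replace_col P v k \<in> carrier_mat n n"
      using P(1) by (auto simp: replace_col_def)
    ultimately show ?case by blast
  qed
  from this [of n] show ?thesis by simp
qed

text \<open>The projection of \<open>v\<close> onto a suitable eigenspace of \<open>M\<close>; it commutes with
  everything that commutes with \<open>M\<close>, so it preserves the eigenvector property for those matrices.\<close>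

lemma eigenvector_refinement:
  fixes M :: "'a::field mat"
  assumes M: "M \<in> carrier_mat n n" and diag: "diagonalizable M"
    and v: "v \<in> carrier_vec n" and y: "y \<in> carrier_vec n" and yv: "scalar_prod y v \<noteq> 0"
  obtains v' where "v' \<in> carrier_vec n" "scalar_prod y v' \<noteq> 0" "\<exists>\<mu>. M *\<^sub>v v' = \<mu> \<cdot>\<^sub>v v'"
    "\<And>N l. N \<in> carrier_mat n n \<Longrightarrow> N * M = M * N \<Longrightarrow> N *\<^sub>v v = l \<cdot>\<^sub>v v \<Longrightarrow> N *\<^sub>v v' = l \<cdot>\<^sub>v v'"
proof -
  obtain D P Q where D: "diagonal_mat D" and wit: "similar_mat_wit M D P Q"
    using diag unfolding diagonalizable_def similar_mat_def by blast
  note wit_props = similar_mat_witD2 [OF M wit]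
  have car: "D \<in> carrier_mat n n" "P \<in> carrier_mat n n" "Q \<in> carrier_mat n n"
    and PQ: "P * Q = 1\<^sub>m n" and QP: "Q * P = 1\<^sub>m n" and MD: "M = P * D * Q"
    using wit_props by blast+
  define d where "d s = D $$ (s, s)" for s
  have Dz: "D *\<^sub>v z = vec n (\<lambda>s. d s * z $ s)" if "z \<in> carrier_vec n" for z
  proof (rule eq_vecI)
    fix s assume "s < dim_vec (vec n (\<lambda>s. d s * z $ s))"
    then have s: "s < n" by simp
    have "(D *\<^sub>v z) $ s = (\<Sum>t<n. D $$ (s, t) * z $ t)"
      using s car that by (simp add: scalar_prod_def atLeast0LessThan)
    also have "\<dots> = (\<Sum>t<n. if t = s then d s * z $ s else 0)"
      using D s car by (intro sum.cong) (auto simp: diagonal_mat_def d_def)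
    finally show "(D *\<^sub>v z) $ s = vec n (\<lambda>s. d s * z $ s) $ s" using s by simp
  qed (use car in auto)
  \<comment> \<open>In the eigenbasis of \<open>M\<close>, the vector \<open>v\<close> has the
    coordinates \<open>w\<close> and the functional \<open>y\<close> has the coordinates
    \<open>g\<close>.\<close>
  define w where "w = Q *\<^sub>v v"
  define g where "g = transpose_mat P *\<^sub>v y"
  have w: "w \<in> carrier_vec n" and g: "g \<in> carrier_vec n"
    using car v y by (auto simp: w_def g_def)
  have Pw: "P *\<^sub>v w = v"
    unfolding w_def using car PQ v by (metis assoc_mult_mat_vec one_mult_mat_vec)
  have yP: "scalar_prod y (P *\<^sub>v z) = (\<Sum>s<n. g $ s * z $ s)" if "z \<in> carrier_vec n" for z
  proof -
    have "scalar_prod y (P *\<^sub>v z) = (\<Sum>i<n. \<Sum>s<n. y $ i * (P $$ (i, s) * z $ s))"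
      using car y that by (simp add: scalar_prod_def atLeast0LessThan sum_distrib_left)
    also have "\<dots> = (\<Sum>s<n. \<Sum>i<n. y $ i * (P $$ (i, s) * z $ s))"
      by (rule sum.swap)
    also have "\<dots> = (\<Sum>s<n. g $ s * z $ s)"
      using car y by (simp add: g_def scalar_prod_def atLeast0LessThan sum_distrib_left sum_distrib_right mult_ac)
    finally show ?thesis .
  qed
  \<comment> \<open>Grouping by eigenvalue splits the value of \<open>y\<close> at \<open>v\<close>
    into its values at the projections of \<open>v\<close> onto the eigenspaces. The total is
    nonzero, so some projection contributes.\<close>
  have "(\<Sum>s<n. g $ s * w $ s) = (\<Sum>\<mu>\<in>d ` {..<n}. \<Sum>s\<in>{s \<in> {..<n}. d s = \<mu>}. g $ s * w $ s)"
    by (rule sum.group [symmetric]) auto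
  with yP [OF w] yv Pw have "(\<Sum>\<mu>\<in>d ` {..<n}. \<Sum>s\<in>{s \<in> {..<n}. d s = \<mu>}. g $ s * w $ s) \<noteq> 0"
    by simp
  then obtain \<mu> where \<mu>: "(\<Sum>s\<in>{s \<in> {..<n}. d s = \<mu>}. g $ s * w $ s) \<noteq> 0"
    by (rule sum.not_neutral_contains_not_neutral)
  define z where "z = vec n (\<lambda>s. if d s = \<mu> then w $ s else 0)"
  have z: "z \<in> carrier_vec n" by (simp add: z_def)
  show thesis
  proof (rule that [of "P *\<^sub>v z"])
    show "P *\<^sub>v z \<in> carrier_vec n" using car z by simp
    have "(\<Sum>s\<in>{s \<in> {..<n}. d s = \<mu>}. g $ s * w $ s) = (\<Sum>s<n. g $ s * z $ s)"
      by (intro sum.mono_neutral_cong_left) (auto simp: z_def)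
    with \<mu> yP [OF z] show "scalar_prod y (P *\<^sub>v z) \<noteq> 0" by simp
    have "D *\<^sub>v z = \<mu> \<cdot>\<^sub>v z"
      unfolding Dz [OF z] by (rule eq_vecI) (auto simp: z_def)
    moreover have "M *\<^sub>v (P *\<^sub>v z) = P *\<^sub>v (D *\<^sub>v z)"
    proof -
      have "M *\<^sub>v (P *\<^sub>v z) = P *\<^sub>v (D *\<^sub>v (Q *\<^sub>v (P *\<^sub>v z)))"
        unfolding MD using car z by (simp add: square_simps square_mult_vec_assoc)
      also have "Q *\<^sub>v (P *\<^sub>v z) = z" using car QP z by (metis assoc_mult_mat_vec one_mult_mat_vec)
      finally show ?thesis .
    qed
    ultimately have "M *\<^sub>v (P *\<^sub>v z) = \<mu> \<cdot>\<^sub>v (P *\<^sub>v z)"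
      by (simp only: mult_mat_vec [OF car(2) z])
    then show "\<exists>\<mu>. M *\<^sub>v (P *\<^sub>v z) = \<mu> \<cdot>\<^sub>v (P *\<^sub>v z)" ..
    fix N l assume N: "N \<in> carrier_mat n n" and comm: "N * M = M * N" and Nv: "N *\<^sub>v v = l \<cdot>\<^sub>v v"
    define N' where "N' = Q * N * P"
    have N': "N' \<in> carrier_mat n n" using car N by (simp add: N'_def)
    have QM: "Q * M = D * Q"
      unfolding MD using car by (simp add: square_simps inverse_mult_cancel [OF QP])
    have MP: "M * P = P * D"
      unfolding MD using car QP by (simp add: square_simps)
    have "N' * D = Q * N * (M * P)"
      unfolding N'_def MP using car N by (simp add: square_simps)
    also have "\<dots> = Q * (N * M) * P"
      using car N M by (simp add: square_simps)
    also have "\<dots> = (Q * M) * N * P"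
      unfolding comm using car N M by (simp add: square_simps)
    also have "\<dots> = D * N'"
      unfolding QM N'_def using car N by (simp add: square_simps)
    finally have ND: "N' * D = D * N'" .
    \<comment> \<open>Entry \<open>(a, b)\<close> of \<open>N' * D = D * N'\<close> is
      \<open>N' $$ (a, b) * d b = d a * N' $$ (a, b)\<close>, so \<open>N'\<close> does not mix
      different eigenvalues.\<close>
    have block: "N' $$ (a, b) = 0" if "a < n" "b < n" "d a \<noteq> d b" for a b
    proof -
      have "(N' * D) $$ (a, b) = (\<Sum>k<n. if k = b then N' $$ (a, b) * d b else 0)"
        unfolding index_mult_mat_sum [OF N' car(1) that(1,2)]
        using D car that by (intro sum.cong) (auto simp: diagonal_mat_def d_def)
      moreover have "(D * N') $$ (a, b) = (\<Sum>k<n. if k = a then N' $$ (a, b) * d a else 0)"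
        unfolding index_mult_mat_sum [OF car(1) N' that(1,2)]
        using D car that by (intro sum.cong) (auto simp: diagonal_mat_def d_def)
      ultimately show ?thesis using that ND by simp
    qed
    have N'w: "N' *\<^sub>v w = l \<cdot>\<^sub>v w"
    proof -
      have "N' *\<^sub>v w = Q *\<^sub>v (N *\<^sub>v (P *\<^sub>v w))"
        unfolding N'_def using car N w by (simp add: square_simps square_mult_vec_assoc)
      also have "\<dots> = l \<cdot>\<^sub>v w"
        unfolding Pw Nv mult_mat_vec [OF car(3) v] by (simp only: w_def)
      finally show ?thesis .
    qed
    \<comment> \<open>By the block structure, cutting \<open>w\<close> down to the coordinates of
      eigenvalue \<mu> commutes with applying \<open>N'\<close>.\<close>
    have "N' *\<^sub>v z = l \<cdot>\<^sub>v z"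
    proof (rule eq_vecI)
      fix a assume "a < dim_vec (l \<cdot>\<^sub>v z)"
      then have a: "a < n" using z by simp
      have Nz: "(N' *\<^sub>v z) $ a = (\<Sum>b<n. N' $$ (a, b) * (if d b = \<mu> then w $ b else 0))"
        using N' a by (simp add: scalar_prod_def atLeast0LessThan z_def)
      show "(N' *\<^sub>v z) $ a = (l \<cdot>\<^sub>v z) $ a"
      proof (cases "d a = \<mu>")
        case True
        have "(N' *\<^sub>v z) $ a = (\<Sum>b<n. N' $$ (a, b) * w $ b)"
          unfolding Nz using block [OF a] True by (intro sum.cong) force+
        also have "\<dots> = (N' *\<^sub>v w) $ a"
          using N' w a by (simp add: scalar_prod_def atLeast0LessThan)
        finally show ?thesis unfolding N'w using a w True by (simp add: z_def)
      next
        case False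
        have "(N' *\<^sub>v z) $ a = 0"
          unfolding Nz using block [OF a] False by (intro sum.neutral) force
        then show ?thesis using a False by (simp add: z_def)
      qed
    qed (use N' z in auto)
    moreover have "N *\<^sub>v (P *\<^sub>v z) = P *\<^sub>v (N' *\<^sub>v z)"
    proof -
      have "P * N' = N * P"
        unfolding N'_def using car N by (simp add: square_simps inverse_mult_cancel [OF PQ])
      then show ?thesis
        using square_mult_vec_assoc [OF car(2) N' z] square_mult_vec_assoc [OF N car(2) z] by simp
    qed
    ultimately show "N *\<^sub>v (P *\<^sub>v z) = l \<cdot>\<^sub>v (P *\<^sub>v z)"
      by (simp only: mult_mat_vec [OF car(2) z])
  qed
qed

text \<open>A unit vector at a nonzero coordinate of \<open>y\<close> starts an induction on
  \<open>F\<close>. For each new matrix the vector is projected onto one of its eigenspaces on which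
  \<open>y\<close> stays nonzero; commutation preserves the eigenvector equations obtained
  before.\<close>

lemma joint_eigenvector_separates:
  fixes F :: "'a::field mat set"
  assumes "finite F" "F \<subseteq> carrier_mat n n"
    and "\<And>M. M \<in> F \<Longrightarrow> diagonalizable M"
    and "\<And>M N. M \<in> F \<Longrightarrow> N \<in> F \<Longrightarrow> M * N = N * M"
    and y: "y \<in> carrier_vec n" "y \<noteq> 0\<^sub>v n"
  shows "\<exists>v\<in>carrier_vec n. scalar_prod y v \<noteq> 0 \<and> (\<forall>M\<in>F. \<exists>\<mu>. M *\<^sub>v v = \<mu> \<cdot>\<^sub>v v)"
  using assms(1-4)
proof (induction F)
  case empty
  obtain i where "i < n" "y $ i \<noteq> 0" using y by (metis carrier_vecD eq_vecI index_zero_vec)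
  then show ?case using y by (intro bexI [of _ "unit_vec n i"]) auto
next
  case (insert M F)
  then obtain v where v: "v \<in> carrier_vec n" "scalar_prod y v \<noteq> 0" "\<forall>N\<in>F. \<exists>\<mu>. N *\<^sub>v v = \<mu> \<cdot>\<^sub>v v"
    by auto
  obtain v' where v': "v' \<in> carrier_vec n" "scalar_prod y v' \<noteq> 0" "\<exists>\<mu>. M *\<^sub>v v' = \<mu> \<cdot>\<^sub>v v'"
    "\<And>N l. N \<in> carrier_mat n n \<Longrightarrow> N * M = M * N \<Longrightarrow> N *\<^sub>v v = l \<cdot>\<^sub>v v \<Longrightarrow> N *\<^sub>v v' = l \<cdot>\<^sub>v v'"
    using eigenvector_refinement [of M n v y] insert.prems v y by blast
  have "\<exists>\<mu>. N *\<^sub>v v' = \<mu> \<cdot>\<^sub>v v'" if "N \<in> F" for N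
    using v(3) v'(4) [of N] that insert.prems by blast
  with v' show ?case by auto
qed

text \<open>The joint eigenvectors of \<open>F\<close> are separated by every nonzero functional, so
  they contain a basis, which supplies the columns of \<open>P\<close>.\<close>

lemma simultaneous_diagonalization:
  fixes F :: "'a::field mat set"
  assumes "finite F" "F \<subseteq> carrier_mat n n"
    and "\<And>M. M \<in> F \<Longrightarrow> diagonalizable M"
    and "\<And>M N. M \<in> F \<Longrightarrow> N \<in> F \<Longrightarrow> M * N = N * M"
  obtains P Q where "P \<in> carrier_mat n n" "Q \<in> carrier_mat n n" "P * Q = 1\<^sub>m n" "Q * P = 1\<^sub>m n"
    "\<And>M s. M \<in> F \<Longrightarrow> s < n \<Longrightarrow> \<exists>\<mu>. M *\<^sub>v col P s = \<mu> \<cdot>\<^sub>v col P s"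
proof -
  let ?V = "{v \<in> carrier_vec n. \<forall>M\<in>F. \<exists>\<mu>. M *\<^sub>v v = \<mu> \<cdot>\<^sub>v v}"
  have "\<exists>P\<in>carrier_mat n n. Determinant.det P \<noteq> 0 \<and> (\<forall>j<n. col P j \<in> ?V)"
    using joint_eigenvector_separates [OF assms]
    by (intro invertible_columns_from_separating_set) blast+
  then obtain P where P: "P \<in> carrier_mat n n" "Determinant.det P \<noteq> 0" "\<forall>j<n. col P j \<in> ?V"
    by blast
  obtain Q where Q: "Q \<in> carrier_mat n n" "P * Q = 1\<^sub>m n" "Q * P = 1\<^sub>m n"
    using inverse_if_det_nonzero [OF P(1,2)] .
  show thesis
    by (rule that [OF P(1) Q]) (use P(3) in auto)
qed

text \<open>Simultaneous diagonalization writes \<open>H k i j\<close> as a sum of \<open>n\<close>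
  products of three factors, one for each index. The symmetry of \<open>H\<close> makes the three
  factors proportional, so that each product becomes a multiple of a cube.\<close>

lemma symmetric_slices_sum_of_cubes:
  fixes H :: "nat \<Rightarrow> nat \<Rightarrow> nat \<Rightarrow> 'a::field" and n :: nat
  defines "T \<equiv> \<lambda>k. Matrix.mat n n (\<lambda>(i, j). H k i j)"
  assumes n: "n \<ge> 1"
    and sym: "\<And>i j k. i < n \<Longrightarrow> j < n \<Longrightarrow> k < n \<Longrightarrow> H i j k = H j i k \<and> H i j k = H i k j"
    and X: "X \<in> carrier_mat n n" "X * T 0 = 1\<^sub>m n" "T 0 * X = 1\<^sub>m n"
    and diag: "\<And>k. k \<in> {1..<n} \<Longrightarrow> diagonalizable (X * T k)"
    and comm: "\<And>k l. k \<in> {1..<n} \<Longrightarrow> l \<in> {1..<n} \<Longrightarrow> (X * T k) * (X * T l) = (X * T l) * (X * T k)"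
  obtains Q Q' c where "Q \<in> carrier_mat n n" "Q' \<in> carrier_mat n n" "Q * Q' = 1\<^sub>m n"
    "\<And>s. s < n \<Longrightarrow> c s \<noteq> 0"
    "\<And>i j k. i < n \<Longrightarrow> j < n \<Longrightarrow> k < n \<Longrightarrow> H i j k = (\<Sum>s<n. c s * (Q $$ (s, i) * Q $$ (s, j) * Q $$ (s, k)))"
proof -
  have T: "T k \<in> carrier_mat n n" for k by (simp add: T_def)
  have idx: "T k $$ (i, j) = H k i j" if "i < n" "j < n" for i j k using that by (simp add: T_def)
  obtain P Q where P: "P \<in> carrier_mat n n" and Q: "Q \<in> carrier_mat n n"
    and PQ: "P * Q = 1\<^sub>m n" and QP: "Q * P = 1\<^sub>m n"
    and eig: "\<And>M s. M \<in> (\<lambda>k. X * T k) ` {1..<n} \<Longrightarrow> s < n \<Longrightarrow> \<exists>\<mu>. M *\<^sub>v col P s = \<mu> \<cdot>\<^sub>v col P s"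
    by (rule simultaneous_diagonalization [of "(\<lambda>k. X * T k) ` {1..<n}" n])
       (use X(1) T diag comm in auto)
  define S where "S = T 0 * P"
  have S: "S \<in> carrier_mat n n" unfolding S_def by (rule mult_carrier_mat [OF T P])
  \<comment> \<open>Multiplying the eigenvector equation of \<open>X * T k\<close> by
    \<open>T 0\<close> shows that column \<open>s\<close> of \<open>T k * P\<close> is a multiple of
    column \<open>s\<close> of \<open>S\<close>. Slice 0 lies outside the diagonalized family; its
    factor is 1 because \<open>S = T 0 * P\<close>.\<close>
  have "\<exists>d. d 0 = 1 \<and> (\<forall>k<n. \<forall>i<n. (T k * P) $$ (i, s) = S $$ (i, s) * d k)" if s: "s < n" for s
  proof -
    have "\<exists>\<mu>. (k = 0 \<longrightarrow> \<mu> = 1) \<and> (\<forall>i<n. (T k * P) $$ (i, s) = S $$ (i, s) * \<mu>)" if k: "k < n" for k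
    proof (cases "k = 0")
      case True
      then show ?thesis by (auto simp: S_def)
    next
      case False
      with k s obtain \<mu> where \<mu>: "(X * T k) *\<^sub>v col P s = \<mu> \<cdot>\<^sub>v col P s"
        using eig [of "X * T k" s] by auto
      have cP: "col P s \<in> carrier_vec n" using P s by auto
      have "T 0 * (X * T k) = T k"
        by (rule inverse_mult_cancel [OF X(3) T X(1) T])
      then have "T k *\<^sub>v col P s = T 0 *\<^sub>v ((X * T k) *\<^sub>v col P s)"
        using square_mult_vec_assoc [OF T [of 0] square_mult_carrier [OF X(1) T] cP, of k] by simp
      also have "\<dots> = \<mu> \<cdot>\<^sub>v (T 0 *\<^sub>v col P s)"
        unfolding \<mu> using mult_mat_vec [OF T cP] .
      finally have *: "T k *\<^sub>v col P s = \<mu> \<cdot>\<^sub>v (T 0 *\<^sub>v col P s)" .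
      have "(T k * P) $$ (i, s) = S $$ (i, s) * \<mu>" if "i < n" for i
        using arg_cong [OF *, of "\<lambda>v. v $ i"] that s P T [of 0] T [of k] by (simp add: S_def mult_ac)
      with False show ?thesis by blast
    qed
    then obtain d where "\<And>k. k < n \<Longrightarrow> (k = 0 \<longrightarrow> d k = 1) \<and> (\<forall>i<n. (T k * P) $$ (i, s) = S $$ (i, s) * d k)"
      by metis
    with n show ?thesis by (intro exI [of _ d]) auto
  qed
  then obtain d' where d': "\<And>s. s < n \<Longrightarrow> d' s 0 = 1 \<and> (\<forall>k<n. \<forall>i<n. (T k * P) $$ (i, s) = S $$ (i, s) * d' s k)"
    by metis
  define d where "d k s = d' s k" for k s
  have H: "H k i j = (\<Sum>s<n. S $$ (i, s) * d k s * Q $$ (s, j))" if "i < n" "j < n" "k < n" for i j k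
  proof -
    have "T k = T k * P * Q"
      using square_mult_assoc [OF T [of k] P Q] T [of k] PQ by simp
    then have "H k i j = (T k * P * Q) $$ (i, j)" using that by (metis idx)
    also have "\<dots> = (\<Sum>s<n. (T k * P) $$ (i, s) * Q $$ (s, j))"
      by (rule index_mult_mat_sum [OF square_mult_carrier [OF T P] Q that(1,2)])
    also have "\<dots> = (\<Sum>s<n. S $$ (i, s) * d k s * Q $$ (s, j))"
      using d' that by (intro sum.cong) (auto simp: d_def)
    finally show ?thesis .
  qed
  have S'S: "(Q * X) * S = 1\<^sub>m n"
    unfolding S_def using T [of 0] X P Q QP by (simp add: square_simps inverse_mult_cancel [OF X(2)])
  \<comment> \<open>Exchanging the slice index \<open>k\<close> with the column index
    \<open>j\<close> gives two combinations of the columns of \<open>S\<close>. These are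
    independent by \<open>S'S\<close>, so the coefficients agree.\<close>
  have dQ: "d k s * Q $$ (s, j) = d j s * Q $$ (s, k)" if "s < n" "j < n" "k < n" for s j k
  proof -
    have "d k s * Q $$ (s, j) - d j s * Q $$ (s, k) = 0"
    proof (rule kernel_trivial_if_left_inverse [OF S _ S'S _ \<open>s < n\<close>])
      show "Q * X \<in> carrier_mat n n" using Q X by simp
      fix i assume i: "i < n"
      have "H k i j = H j i k" using sym i that by metis
      then show "(\<Sum>s<n. S $$ (i, s) * (d k s * Q $$ (s, j) - d j s * Q $$ (s, k))) = 0"
        unfolding H [OF i that(2,3)] H [OF i that(3,2)]
        by (simp add: right_diff_distrib sum_subtractf mult.assoc)
    qed
    then show ?thesis by simp
  qed
  \<comment> \<open>The case \<open>k = 0\<close>, where \<open>d 0 s = 1\<close>: row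
    \<open>s\<close> of \<open>Q\<close> is a multiple of its first entry, which therefore cannot
    vanish.\<close>
  have Qd: "Q $$ (s, j) = d j s * Q $$ (s, 0)" if "s < n" "j < n" for s j
    using dQ [of s j 0] d' [of s] that n by (simp add: d_def)
  have Q0: "Q $$ (s, 0) \<noteq> 0" if s: "s < n" for s
  proof
    assume "Q $$ (s, 0) = 0"
    then have "Q $$ (s, j) = 0" if "j < n" for j using Qd [OF s that] by simp
    then show False
      using index_mult_mat_sum [OF Q P s s] QP s by simp
  qed
  have H': "H k i j = (\<Sum>s<n. S $$ (i, s) * Q $$ (s, j) / Q $$ (s, 0) * Q $$ (s, k))"
    if "i < n" "j < n" "k < n" for i j k
    unfolding H [OF that]
  proof (rule sum.cong)
    fix s assume "s \<in> {..<n}"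
    then show "S $$ (i, s) * d k s * Q $$ (s, j) = S $$ (i, s) * Q $$ (s, j) / Q $$ (s, 0) * Q $$ (s, k)"
      using Qd [of s k] Q0 [of s] that by (simp add: field_simps)
  qed simp
  have P'Q: "transpose_mat P * transpose_mat Q = 1\<^sub>m n"
    using transpose_mult [OF Q P] QP by simp
  \<comment> \<open>The second comparison exchanges row and column of a slice and uses the
    independence of the rows of \<open>Q\<close>. It says that column \<open>s\<close> of
    \<open>S\<close> is proportional to row \<open>s\<close> of \<open>Q\<close>.\<close>
  have SQ: "S $$ (i, s) * Q $$ (s, j) = S $$ (j, s) * Q $$ (s, i)" if "s < n" "i < n" "j < n" for s i j
  proof -
    have "S $$ (i, s) * Q $$ (s, j) / Q $$ (s, 0) - S $$ (j, s) * Q $$ (s, i) / Q $$ (s, 0) = 0"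
    proof (rule kernel_trivial_if_left_inverse [OF _ _ P'Q _ \<open>s < n\<close>])
      show "transpose_mat Q \<in> carrier_mat n n" "transpose_mat P \<in> carrier_mat n n" using P Q by auto
      fix k assume k: "k < n"
      have "H k i j = H k j i" using sym k that by metis
      then show "(\<Sum>s<n. transpose_mat Q $$ (k, s) *
          (S $$ (i, s) * Q $$ (s, j) / Q $$ (s, 0) - S $$ (j, s) * Q $$ (s, i) / Q $$ (s, 0))) = 0"
        unfolding H' [OF that(2,3) k] H' [OF that(3,2) k] using Q k
        by (simp add: right_diff_distrib sum_subtractf mult_ac)
    qed
    with Q0 [OF that(1)] show ?thesis by (simp add: field_simps)
  qed
  \<comment> \<open>The proportionality factor given by \<open>SQ\<close> at \<open>j = 0\<close>.
    The other factor \<open>Q $$ (s, 0)\<close> of the denominator is the one in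
    \<open>H'\<close>.\<close>
  define c where "c s = S $$ (0, s) / (Q $$ (s, 0))\<^sup>2" for s
  have Sc: "S $$ (i, s) / Q $$ (s, 0) = c s * Q $$ (s, i)" if "s < n" "i < n" for i s
    using SQ [of s i 0] Q0 [of s] that n by (simp add: c_def field_simps power2_eq_square)
  have c0: "c s \<noteq> 0" if "s < n" for s
  proof
    assume "c s = 0"
    then have "S $$ (i, s) = 0" if "i < n" for i using Sc [OF \<open>s < n\<close> that] Q0 [OF \<open>s < n\<close>] by simp
    then have "((Q * X) * S) $$ (s, s) = 0"
      using that Q X S by (subst index_mult_mat_sum [of _ n n]) auto
    with S'S that show False by simp
  qed
  show thesis
  proof (rule that [OF Q P QP c0])
    fix i j k assume ijk: "i < n" "j < n" "k < n"
    have "S $$ (j, s) * Q $$ (s, k) / Q $$ (s, 0) * Q $$ (s, i)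
        = c s * (Q $$ (s, i) * Q $$ (s, j) * Q $$ (s, k))" if "s < n" for s
    proof -
      have "S $$ (j, s) * Q $$ (s, k) / Q $$ (s, 0) * Q $$ (s, i)
          = S $$ (j, s) / Q $$ (s, 0) * (Q $$ (s, k) * Q $$ (s, i))" by simp
      then show ?thesis unfolding Sc [OF that ijk(2)] by (simp only: mult_ac)
    qed
    then show "H i j k = (\<Sum>s<n. c s * (Q $$ (s, i) * Q $$ (s, j) * Q $$ (s, k)))"
      unfolding H' [OF ijk(2,3,1)] by (intro sum.cong) auto
  qed
qed

section \<open>Vanishing probabilities for a random matrix\<close>

text \<open>Conditioned on all other coordinates, at most one value of coordinate \<open>p\<close>
  leads into \<open>E\<close>, and a uniform draw hits a given value with probability at most
  \<open>1 / card S\<close>. Independence allows coordinate \<open>p\<close> to be drawn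
  last.\<close>

lemma prob_at_most_one_value_le:
  fixes S :: "'b set"
  assumes I: "finite I" "p \<in> I" and S: "finite S" "S \<noteq> {}"
    and unique: "\<And>\<omega> x y. fun_upd \<omega> p x \<in> E \<Longrightarrow> fun_upd \<omega> p y \<in> E \<Longrightarrow> x = y"
  shows "measure_pmf.prob (Pi_pmf I dflt (\<lambda>_. pmf_of_set S)) E \<le> 1 / card S"
proof -
  let ?q = "Pi_pmf (I - {p}) dflt (\<lambda>_. pmf_of_set S)"
  have "Pi_pmf I dflt (\<lambda>_. pmf_of_set S)
      = Pi_pmf (insert p (I - {p})) dflt (\<lambda>_. pmf_of_set S)"
    using I by (simp add: insert_absorb)
  also have "\<dots> = pmf_of_set S \<bind> (\<lambda>y. ?q \<bind> (\<lambda>\<omega>. return_pmf (fun_upd \<omega> p y)))"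
    using I by (intro Pi_pmf_insert') auto
  also have "\<dots> = ?q \<bind> (\<lambda>\<omega>. map_pmf (\<lambda>y. fun_upd \<omega> p y) (pmf_of_set S))"
    unfolding map_pmf_def by (rule bind_commute_pmf)
  finally have eq: "Pi_pmf I dflt (\<lambda>_. pmf_of_set S)
      = ?q \<bind> (\<lambda>\<omega>. map_pmf (\<lambda>y. fun_upd \<omega> p y) (pmf_of_set S))" .
  have le: "emeasure (measure_pmf (pmf_of_set S)) ((\<lambda>y. fun_upd \<omega> p y) -` E) \<le> ennreal (1 / real (card S))" for \<omega>
  proof -
    have "card (S \<inter> (\<lambda>y. fun_upd \<omega> p y) -` E) \<le> 1"
      using S(1) unique [of \<omega>] by (intro card_le_Suc0_iff_eq [THEN iffD2, unfolded One_nat_def [symmetric]]) auto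
    then show ?thesis
      using S by (simp add: emeasure_pmf_of_set divide_right_mono)
  qed
  have "emeasure (measure_pmf (Pi_pmf I dflt (\<lambda>_. pmf_of_set S))) E
      \<le> (\<integral>\<^sup>+\<omega>. ennreal (1 / real (card S)) \<partial>measure_pmf ?q)"
    unfolding eq emeasure_bind_pmf emeasure_map_pmf by (intro nn_integral_mono le)
  then show ?thesis
    by (simp add: measure_pmf.emeasure_eq_measure)
qed

text \<open>Laplace expansion along the last row: its cofactors do not involve the corner entry, and
  the cofactor of the corner is the leading minor of order \<open>k\<close>, with sign +1.\<close>

lemma det_corner_affine:
  fixes \<omega> :: "nat \<times> nat \<Rightarrow> 'a::comm_ring_1"
  obtains r where "\<And>x. Determinant.det (Matrix.mat (Suc k) (Suc k) (fun_upd \<omega> (k, k) x))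
    = x * Determinant.det (Matrix.mat k k \<omega>) + r"
proof
  fix x
  let ?M = "\<lambda>x. Matrix.mat (Suc k) (Suc k) (fun_upd \<omega> (k, k) x)"
  have del: "mat_delete (?M x) k j = mat_delete (?M y) k j" for x y j
    by (rule eq_matI) (auto simp: mat_delete_def)
  then have cof: "cofactor (?M x) k j = cofactor (?M 0) k j" for j
    unfolding cofactor_def by metis
  have "mat_delete (?M 0) k k = Matrix.mat k k \<omega>"
    by (rule eq_matI) (auto simp: mat_delete_def)
  then have ck: "cofactor (?M 0) k k = Determinant.det (Matrix.mat k k \<omega>)"
    by (simp add: cofactor_def)
  have "Determinant.det (?M x) = (\<Sum>j<Suc k. ?M x $$ (k, j) * cofactor (?M x) k j)"
    by (rule laplace_expansion_row) auto
  also have "\<dots> = x * Determinant.det (Matrix.mat k k \<omega>) + (\<Sum>j<k. \<omega> (k, j) * cofactor (?M 0) k j)"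
    unfolding cof by (simp add: ck add.commute)
  finally show "Determinant.det (?M x) = x * Determinant.det (Matrix.mat k k \<omega>)
      + (\<Sum>j<k. \<omega> (k, j) * cofactor (?M 0) k j)" .
qed

lemma affine_root_unique:
  fixes a :: "'a::idom"
  assumes "a \<noteq> 0" "a * x + r = 0" "a * y + r = 0"
  shows "x = y"
  using assms by (metis add_right_cancel mult_left_cancel)

text \<open>The empty minor is 1, so a vanishing determinant forces a step from a nonzero leading
  minor to a zero one. The union bound runs over the \<open>n\<close> possible places of this
  step.\<close>

lemma prob_det_zero_le:
  fixes S :: "'a::field set"
  assumes S: "finite S" "S \<noteq> {}"
  shows "measure_pmf.prob (Pi_pmf ({..<n} \<times> {..<n}) 0 (\<lambda>_. pmf_of_set S))
    {\<omega>. Determinant.det (Matrix.mat n n \<omega>) = 0} \<le> n / card S"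
proof -
  let ?P = "Pi_pmf ({..<n} \<times> {..<n}) 0 (\<lambda>_. pmf_of_set S)"
  define E where "E k = {\<omega>. Determinant.det (Matrix.mat k k \<omega>) \<noteq> 0 \<and>
    Determinant.det (Matrix.mat (Suc k) (Suc k) \<omega>) = (0 :: 'a)}" for k
  have "\<exists>k<m. \<omega> \<in> E k" if "Determinant.det (Matrix.mat m m \<omega>) = 0" for m \<omega>
    using that
  proof (induction m)
    case (Suc m)
    then show ?case by (cases "Determinant.det (Matrix.mat m m \<omega>) = 0") (auto simp: E_def less_Suc_eq)
  qed simp
  then have "measure_pmf.prob ?P {\<omega>. Determinant.det (Matrix.mat n n \<omega>) = 0}
      \<le> measure_pmf.prob ?P (\<Union>k<n. E k)"
    by (intro measure_pmf.finite_measure_mono) auto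
  also have "\<dots> \<le> (\<Sum>k<n. measure_pmf.prob ?P (E k))"
    by (intro measure_pmf.finite_measure_subadditive_finite) auto
  also have "\<dots> \<le> (\<Sum>k<n. 1 / card S)"
  proof (rule sum_mono)
    fix k assume k: "k \<in> {..<n}"
    show "measure_pmf.prob ?P (E k) \<le> 1 / card S"
    proof (rule prob_at_most_one_value_le [where p = "(k, k)"])
      fix \<omega> x y assume xy: "fun_upd \<omega> (k, k) x \<in> E k" "fun_upd \<omega> (k, k) y \<in> E k"
      obtain r where r: "\<And>x. Determinant.det (Matrix.mat (Suc k) (Suc k) (fun_upd \<omega> (k, k) x))
          = x * Determinant.det (Matrix.mat k k \<omega>) + r"
        using det_corner_affine [of k \<omega>] by blast
      \<comment> \<open>Coordinate \<open>(k, k)\<close> lies outside the leading block of order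
        \<open>k\<close>, so both updates give affine equations with the same slope, nonzero on
        \<open>E k\<close>.\<close>
      have "Matrix.mat k k (fun_upd \<omega> (k, k) z) = Matrix.mat k k \<omega>" for z
        by (rule eq_matI) auto
      with xy have "Determinant.det (Matrix.mat k k \<omega>) \<noteq> 0"
        and "Determinant.det (Matrix.mat k k \<omega>) * x + r = 0"
        and "Determinant.det (Matrix.mat k k \<omega>) * y + r = 0"
        by (simp_all add: E_def r mult.commute)
      then show "x = y" by (rule affine_root_unique)
    qed (use S k in auto)
  qed
  finally show ?thesis by simp
qed

text \<open>Row \<open>s\<close> of the invertible matrix \<open>A\<close> has a nonzero entry, say
  in column \<open>j\<close>. It is the slope of the product entry as an affine function of the
  coordinate \<open>(j, 0)\<close>.\<close>

lemma prob_entry_zero_le: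
  fixes S :: "'a::field set"
  assumes S: "finite S" "S \<noteq> {}" and A: "A \<in> carrier_mat n n" "Determinant.det A \<noteq> 0"
    and s: "s < n"
  shows "measure_pmf.prob (Pi_pmf ({..<n} \<times> {..<n}) 0 (\<lambda>_. pmf_of_set S))
    {\<omega>. (A * Matrix.mat n n \<omega>) $$ (s, 0) = 0} \<le> 1 / card S"
proof -
  obtain A' where A': "A' \<in> carrier_mat n n" "A * A' = 1\<^sub>m n"
    using inverse_if_det_nonzero [OF A] by blast
  have "(\<Sum>j<n. A $$ (s, j) * A' $$ (j, s)) \<noteq> 0"
    using index_mult_mat_sum [OF A(1) A'(1) s s] A'(2) s by simp
  then obtain j where j: "j < n" "A $$ (s, j) \<noteq> 0"
    by (auto elim: sum.not_neutral_contains_not_neutral)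
  have entry: "(A * Matrix.mat n n (fun_upd \<omega> (j, 0) x)) $$ (s, 0)
      = A $$ (s, j) * x + (\<Sum>i\<in>{..<n} - {j}. A $$ (s, i) * \<omega> (i, 0))" for \<omega> x
  proof -
    have "(A * Matrix.mat n n (fun_upd \<omega> (j, 0) x)) $$ (s, 0) = (\<Sum>i<n. A $$ (s, i) * fun_upd \<omega> (j, 0) x (i, 0))"
      using s by (subst index_mult_mat_sum [OF A(1), of _ n]) auto
    also have "\<dots> = A $$ (s, j) * x + (\<Sum>i\<in>{..<n} - {j}. A $$ (s, i) * \<omega> (i, 0))"
      using j(1) by (subst sum.remove [of _ j]) (auto intro!: sum.cong)
    finally show ?thesis .
  qed
  show ?thesis
  proof (rule prob_at_most_one_value_le [where p = "(j, 0)"])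
    fix \<omega> x y
    assume "fun_upd \<omega> (j, 0) x \<in> {\<omega>. (A * Matrix.mat n n \<omega>) $$ (s, 0) = 0}"
      "fun_upd \<omega> (j, 0) y \<in> {\<omega>. (A * Matrix.mat n n \<omega>) $$ (s, 0) = 0}"
    then show "x = y"
      unfolding mem_Collect_eq entry by (rule affine_root_unique [OF j(2)])
  qed (use S j s in auto)
qed

section \<open>Cubic forms and their slices\<close>

abbreviation unit_exp :: "nat \<Rightarrow> (nat \<Rightarrow>\<^sub>0 nat)" where
  "unit_exp i \<equiv> Poly_Mapping.single i 1"

lemma const_zero [simp]: "const 0 = 0"
  by (simp add: const_def)

lemma const_one [simp]: "const 1 = (1 :: 'a::comm_ring_1 mpoly)"
  by (simp add: const_def)

lemma const_add: "const (a + b) = const a + const (b::'a::comm_ring_1)"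
  by (simp add: const_def single_add)

lemma const_mult: "const (a * b) = const a * const (b::'a::comm_ring_1)"
  by (simp add: const_def mult_single)

lemma const_sum: "const (sum f X) = (\<Sum>x\<in>X. const (f x :: 'a::comm_ring_1))"
  by (induction X rule: infinite_finite_induct) (simp_all add: const_add)

lemma lookup_const_zero [simp]: "Poly_Mapping.lookup (const c) 0 = c"
  by (simp add: const_def)

lemma mpoly_eq_sum_single:
  "(\<Sum>m\<in>Poly_Mapping.keys p. Poly_Mapping.single m (Poly_Mapping.lookup p m)) = (p :: 'a::comm_ring_1 mpoly)"
  by (rule poly_mapping_eqI)
     (auto simp: lookup_sum lookup_single when_def not_in_keys_iff_lookup_eq_zero)

text \<open>Reduces identities that are additive in \<open>p\<close> to single monomials; the zero
  polynomial is the monomial with coefficient 0.\<close>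

lemma mpoly_induct [case_names single sum]:
  assumes single: "\<And>m c. P (Poly_Mapping.single m c)"
    and sum: "\<And>p q. P p \<Longrightarrow> P q \<Longrightarrow> P (p + q)"
  shows "P (p :: 'a::comm_ring_1 mpoly)"
proof -
  have "P (\<Sum>m\<in>X. Poly_Mapping.single m (Poly_Mapping.lookup p m))" for X
  proof (induction X rule: infinite_finite_induct)
    case (insert m X)
    then show ?case using single sum by simp
  qed (use single [of 0 0] in auto)
  from this [of "Poly_Mapping.keys p"] show ?thesis
    by (simp only: mpoly_eq_sum_single)
qed

lemma lookup_const_mult:
  "Poly_Mapping.lookup (const c * p) m = c * Poly_Mapping.lookup (p :: 'a::comm_ring_1 mpoly) m"
proof (induction p rule: mpoly_induct)
  case (single k v)
  then show ?case by (simp add: const_def mult_single lookup_single when_def)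
next
  case (sum p q)
  then show ?case by (simp add: distrib_left lookup_add)
qed

lemma lookup_partial_deriv:
  "Poly_Mapping.lookup (partial_deriv i p) m
     = of_nat (Poly_Mapping.lookup m i + 1) * Poly_Mapping.lookup p (m + unit_exp i)"
proof -
  \<comment> \<open>Truncated subtraction can also send an \<open>m'\<close> with exponent 0 at
    \<open>i\<close> to \<open>m\<close>, but such a term carries the factor 0.\<close>
  have eq: "m' = m + unit_exp i"
    if "m' - unit_exp i = m" "Poly_Mapping.lookup m' i \<noteq> 0" for m' :: "nat \<Rightarrow>\<^sub>0 nat"
    by (rule poly_mapping_eqI)
       (use that in \<open>auto simp: lookup_add lookup_minus lookup_single when_def\<close>)
  have "Poly_Mapping.lookup (partial_deriv i p) m
     = (\<Sum>m'\<in>Poly_Mapping.keys p. if m' = m + unit_exp i then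
          of_nat (Poly_Mapping.lookup m i + 1) * Poly_Mapping.lookup p (m + unit_exp i) else 0)"
    unfolding partial_deriv_def lookup_sum
  proof (rule sum.cong)
    fix m' assume "m' \<in> Poly_Mapping.keys p"
    show "Poly_Mapping.lookup (Poly_Mapping.single (m' - unit_exp i)
        (of_nat (Poly_Mapping.lookup m' i) * Poly_Mapping.lookup p m')) m
      = (if m' = m + unit_exp i then
          of_nat (Poly_Mapping.lookup m i + 1) * Poly_Mapping.lookup p (m + unit_exp i) else 0)"
    proof (cases "m' = m + unit_exp i")
      case True
      then show ?thesis by (simp add: lookup_add)
    next
      case False
      then have "Poly_Mapping.lookup m' i = 0" if "m' - unit_exp i = m" using eq that by blast
      with False show ?thesis by (auto simp: lookup_single when_def)
    qed
  qed simp
  then show ?thesis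
    by (simp add: not_in_keys_iff_lookup_eq_zero)
qed

lemma partial_deriv_add: "partial_deriv i (p + q) = partial_deriv i p + partial_deriv i q"
  by (rule poly_mapping_eqI) (simp add: lookup_partial_deriv lookup_add algebra_simps)

lemma partial_deriv_zero [simp]: "partial_deriv i 0 = 0"
  by (simp add: partial_deriv_def)

lemma partial_deriv_sum: "partial_deriv i (sum f X) = (\<Sum>x\<in>X. partial_deriv i (f x))"
  by (induction X rule: infinite_finite_induct) (simp_all add: partial_deriv_add)

lemma partial_deriv_const_mult: "partial_deriv i (const c * p) = const c * partial_deriv i p"
  by (rule poly_mapping_eqI) (simp only: lookup_partial_deriv lookup_const_mult mult.left_commute)

lemma partial_deriv_single:
  "partial_deriv i (Poly_Mapping.single m c)
     = Poly_Mapping.single (m - unit_exp i) (of_nat (Poly_Mapping.lookup m i) * c)"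
  by (cases "c = 0") (simp_all add: partial_deriv_def)

text \<open>The Leibniz rule for a variable as one factor, which suffices for products of three
  variables. The case split on the exponent of \<open>i\<close> isolates the truncation in
  \<open>m - unit_exp i\<close>.\<close>

lemma partial_deriv_var_mult:
  "partial_deriv i (var a * p) = (if i = a then p else 0) + var a * partial_deriv i p"
proof (induction p rule: mpoly_induct)
  case (single m c)
  show ?case
  proof (cases "Poly_Mapping.lookup m i = 0")
    case True
    have "unit_exp a + m - unit_exp i = m" if "i = a"
      using that by (intro poly_mapping_eqI) (simp add: lookup_add lookup_minus)
    with True show ?thesis
      by (auto simp: var_def mult_single partial_deriv_single lookup_add lookup_single when_def)
  next
    case False
    have "unit_exp a + m - unit_exp i = unit_exp a + (m - unit_exp i)"
      using False
      by (intro poly_mapping_eqI) (auto simp: lookup_add lookup_minus lookup_single when_def)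
    moreover have "unit_exp a + (m - unit_exp i) = m" if "i = a"
      using that False
      by (intro poly_mapping_eqI) (auto simp: lookup_add lookup_minus lookup_single when_def)
    ultimately show ?thesis
      by (auto simp: var_def mult_single partial_deriv_single lookup_add lookup_single when_def
          distrib_right single_add)
  qed
next
  case (sum p q)
  then show ?case by (simp add: distrib_left partial_deriv_add)
qed

section \<open>Homogeneous forms and Euler's identity\<close>

lemma homogeneous_in_vars_iff:
  "in_vars n p \<and> homogeneous d p \<longleftrightarrow>
     (\<forall>m\<in>Poly_Mapping.keys p. Poly_Mapping.keys m \<subseteq> {..<n} \<and>
        (\<Sum>i<n. Poly_Mapping.lookup m i) = d)"
proof -
  have "(\<Sum>i\<in>Poly_Mapping.keys m. Poly_Mapping.lookup m i) = (\<Sum>i<n. Poly_Mapping.lookup m i)"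
    if "Poly_Mapping.keys m \<subseteq> {..<n}" for m :: "nat \<Rightarrow>\<^sub>0 nat"
    using that by (intro sum.mono_neutral_left) (auto simp: not_in_keys_iff_lookup_eq_zero)
  then show ?thesis
    unfolding in_vars_def homogeneous_def by (metis (no_types, lifting))
qed

lemma partial_deriv_form:
  assumes "in_vars n p \<and> homogeneous (Suc d) p" and i: "i < n"
  shows "in_vars n (partial_deriv i p) \<and> homogeneous d (partial_deriv i p)"
  unfolding homogeneous_in_vars_iff
proof
  fix m assume "m \<in> Poly_Mapping.keys (partial_deriv i p)"
  then have "m + unit_exp i \<in> Poly_Mapping.keys p"
    by (auto simp: in_keys_iff lookup_partial_deriv)
  with assms(1) have *: "Poly_Mapping.keys (m + unit_exp i) \<subseteq> {..<n}"
    "(\<Sum>l<n. Poly_Mapping.lookup (m + unit_exp i) l) = Suc d"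
    unfolding homogeneous_in_vars_iff by blast+
  have "(\<Sum>l<n. Poly_Mapping.lookup (m + unit_exp i) l) = (\<Sum>l<n. Poly_Mapping.lookup m l) + 1"
    using i by (simp add: lookup_add sum.distrib lookup_single when_def)
  moreover have "Poly_Mapping.keys m \<subseteq> Poly_Mapping.keys (m + unit_exp i)"
    by (auto simp: in_keys_iff lookup_add)
  ultimately show "Poly_Mapping.keys m \<subseteq> {..<n} \<and> (\<Sum>l<n. Poly_Mapping.lookup m l) = d"
    using * by auto
qed

lemma form_degree_zero:
  assumes "in_vars n p \<and> homogeneous 0 p"
  shows "p = const (Poly_Mapping.lookup p 0)"
proof (rule poly_mapping_eqI)
  fix m
  have "m = 0" if "m \<in> Poly_Mapping.keys p"
  proof -
    from that assms have "Poly_Mapping.keys m \<subseteq> {..<n}" "(\<Sum>i<n. Poly_Mapping.lookup m i) = 0"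
      unfolding homogeneous_in_vars_iff by blast+
    then have "\<forall>i\<in>Poly_Mapping.keys m. Poly_Mapping.lookup m i = 0" by auto
    then show ?thesis by (intro poly_mapping_eqI) (auto simp: in_keys_iff)
  qed
  then show "Poly_Mapping.lookup p m = Poly_Mapping.lookup (const (Poly_Mapping.lookup p 0)) m"
    by (auto simp: const_def lookup_single when_def in_keys_iff)
qed

text \<open>On a monomial, differentiating by \<open>x_i\<close> and multiplying by
  \<open>x_i\<close> again gives the exponent of \<open>x_i\<close> as a factor. These exponents add
  up to the degree.\<close>

lemma euler_identity:
  assumes "in_vars n p \<and> homogeneous d p"
  shows "(\<Sum>i<n. var i * partial_deriv i p) = const (of_nat d) * p"
proof -
  let ?K = "Poly_Mapping.keys p" and ?c = "Poly_Mapping.lookup p"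
  have monomial: "var i * Poly_Mapping.single (m - unit_exp i) (of_nat (Poly_Mapping.lookup m i) * ?c m)
      = Poly_Mapping.single m (of_nat (Poly_Mapping.lookup m i) * ?c m)" for i m
  proof (cases "Poly_Mapping.lookup m i = 0")
    case False
    then have "unit_exp i + (m - unit_exp i) = m"
      by (intro poly_mapping_eqI) (auto simp: lookup_add lookup_minus lookup_single when_def)
    then show ?thesis by (simp add: var_def mult_single)
  qed simp
  have "(\<Sum>i<n. var i * partial_deriv i p)
      = (\<Sum>i<n. \<Sum>m\<in>?K. Poly_Mapping.single m (of_nat (Poly_Mapping.lookup m i) * ?c m))"
    by (simp only: partial_deriv_def sum_distrib_left monomial)
  also have "\<dots> = (\<Sum>m\<in>?K. \<Sum>i<n. Poly_Mapping.single m (of_nat (Poly_Mapping.lookup m i) * ?c m))"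
    by (rule sum.swap)
  also have "\<dots> = (\<Sum>m\<in>?K. const (of_nat d) * Poly_Mapping.single m (?c m))"
  proof (rule sum.cong)
    fix m assume "m \<in> ?K"
    then have d: "d = (\<Sum>i<n. Poly_Mapping.lookup m i)"
      using assms unfolding homogeneous_in_vars_iff by metis
    show "(\<Sum>i<n. Poly_Mapping.single m (of_nat (Poly_Mapping.lookup m i) * ?c m))
        = const (of_nat d) * Poly_Mapping.single m (?c m)"
      unfolding d
      by (rule poly_mapping_eqI)
         (auto simp: const_def mult_single lookup_sum lookup_single when_def sum_distrib_right)
  qed simp
  also have "\<dots> = const (of_nat d) * p"
    by (simp only: sum_distrib_left [symmetric] mpoly_eq_sum_single)
  finally show ?thesis .
qed

section \<open>Cubic forms and symmetric tensors\<close>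

definition triples :: "nat \<Rightarrow> (nat \<times> nat \<times> nat) set" where
  "triples n = {..<n} \<times> {..<n} \<times> {..<n}"

lemma finite_triples [simp]: "finite (triples n)"
  by (simp add: triples_def)

lemma sum_triples: "(\<Sum>(i, j, k)\<in>triples n. f i j k) = (\<Sum>i<n. \<Sum>j<n. \<Sum>k<n. f i j k)"
  by (simp add: triples_def sum.cartesian_product)

lemma product_sum_triples:
  fixes f g h :: "nat \<Rightarrow> 'a::comm_semiring_0"
  shows "(\<Sum>a<n. f a) * (\<Sum>b<n. g b) * (\<Sum>c<n. h c) = (\<Sum>(a, b, c)\<in>triples n. f a * g b * h c)"
proof -
  have "(\<Sum>a<n. f a) * (\<Sum>b<n. g b) = (\<Sum>a<n. \<Sum>b<n. f a * g b)"
    by (rule sum_product)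
  then have "(\<Sum>a<n. f a) * (\<Sum>b<n. g b) * (\<Sum>c<n. h c)
      = (\<Sum>a<n. \<Sum>b<n. (f a * g b) * (\<Sum>c<n. h c))"
    by (simp only: sum_distrib_right)
  then show ?thesis
    by (simp add: sum_triples sum_distrib_left)
qed

text \<open>The sum runs over ordered triples, so each monomial collects all orderings of its
  indices. With the single index set \<open>triples\<close>, two triple sums can be exchanged in one
  step.\<close>

definition cubic_form :: "nat \<Rightarrow> (nat \<Rightarrow> nat \<Rightarrow> nat \<Rightarrow> 'a) \<Rightarrow> 'a::comm_ring_1 mpoly" where
  "cubic_form n G = (\<Sum>(i, j, k)\<in>triples n. const (G i j k) * (var i * var j * var k))"

definition symmetric_tensor :: "nat \<Rightarrow> (nat \<Rightarrow> nat \<Rightarrow> nat \<Rightarrow> 'a) \<Rightarrow> bool" where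
  "symmetric_tensor n G \<longleftrightarrow>
     (\<forall>i<n. \<forall>j<n. \<forall>k<n. G i j k = G j i k \<and> G i j k = G i k j)"

definition slice_tensor :: "nat \<Rightarrow> 'a::field_char_0 mpoly \<Rightarrow> nat \<Rightarrow> nat \<Rightarrow> nat \<Rightarrow> 'a" where
  "slice_tensor n f i j k = slice n f i $$ (j, k)"

text \<open>The covariant transformation of a tensor of order 3: the tensor of the form after the
  substitution of \<open>R x\<close> for \<open>x\<close>.\<close>

definition pullback :: "nat \<Rightarrow> (nat \<Rightarrow> nat \<Rightarrow> nat \<Rightarrow> 'a) \<Rightarrow> 'a::comm_ring_1 mat \<Rightarrow> nat \<Rightarrow> nat \<Rightarrow> nat \<Rightarrow> 'a"
  where "pullback n G R a b c =
    (\<Sum>(i, j, k)\<in>triples n. G i j k * (R $$ (i, a) * R $$ (j, b) * R $$ (k, c)))"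

lemma cubic_form_cong:
  assumes "\<And>i j k. i < n \<Longrightarrow> j < n \<Longrightarrow> k < n \<Longrightarrow> G i j k = H i j k"
  shows "cubic_form n G = cubic_form n H"
  unfolding cubic_form_def using assms by (intro sum.cong) (auto simp: triples_def)

lemma symmetric_slice_tensor: "symmetric_tensor n (slice_tensor n f)"
  by (auto simp: symmetric_tensor_def slice_tensor_def slice_def lookup_partial_deriv lookup_add
      lookup_single when_def add_ac)

text \<open>Euler's identity in degrees 3, 2 and 1 expresses \<open>6 f\<close> through the third
  partial derivatives, which are constants. The factor 6 cancels in characteristic 0.\<close>

lemma cubic_form_slice_tensor:
  assumes f: "in_vars n f \<and> homogeneous 3 (f :: 'a::field_char_0 mpoly)"
  shows "f = cubic_form n (slice_tensor n f)"
proof -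
  let ?D = partial_deriv
  let ?L = "\<lambda>i j k. Poly_Mapping.lookup (?D k (?D j (?D i f))) 0"
  have 0: "in_vars n f \<and> homogeneous (Suc (Suc (Suc 0))) f"
    using f by (simp add: numeral_3_eq_3)
  have 1: "const 2 * ?D i f = (\<Sum>j<n. \<Sum>k<n. const (?L i j k) * (var j * var k))" if "i < n" for i
  proof -
    have "const 2 * ?D i f = (\<Sum>j<n. var j * ?D j (?D i f))"
      using euler_identity [OF partial_deriv_form [OF 0 that]] by (simp add: numeral_2_eq_2)
    also have "\<dots> = (\<Sum>j<n. \<Sum>k<n. const (?L i j k) * (var j * var k))"
    proof (rule sum.cong)
      fix j assume "j \<in> {..<n}"
      then have j: "j < n" by simp
      note ij = partial_deriv_form [OF partial_deriv_form [OF 0 that] j]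
      have "?D j (?D i f) = (\<Sum>k<n. var k * ?D k (?D j (?D i f)))"
        using euler_identity [OF ij] by simp
      also have "\<dots> = (\<Sum>k<n. var k * const (?L i j k))"
        by (intro sum.cong arg_cong2 [where f = "(*)"] refl
            form_degree_zero [OF partial_deriv_form [OF ij]]) simp
      finally have *: "?D j (?D i f) = (\<Sum>k<n. var k * const (?L i j k))" .
      show "var j * ?D j (?D i f) = (\<Sum>k<n. const (?L i j k) * (var j * var k))"
        by (subst *) (simp add: sum_distrib_left mult_ac)
    qed simp
    finally show ?thesis .
  qed
  have "const 6 * f = const 2 * (const 3 * f)"
    by (simp only: mult.assoc [symmetric] const_mult [symmetric]) simp
  also have "const 3 * f = (\<Sum>i<n. var i * ?D i f)"
    using euler_identity [OF f] by simp
  also have "const 2 * \<dots> = (\<Sum>i<n. var i * (const 2 * ?D i f))"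
    by (simp add: sum_distrib_left mult_ac)
  also have "\<dots> = (\<Sum>i<n. \<Sum>j<n. \<Sum>k<n. const (?L i j k) * (var i * var j * var k))"
    by (intro sum.cong refl) (subst 1, simp, simp add: sum_distrib_left mult_ac)
  also have "\<dots> = (\<Sum>i<n. \<Sum>j<n. \<Sum>k<n.
      const (6 * slice_tensor n f i j k) * (var i * var j * var k))"
    by (intro sum.cong refl arg_cong2 [where f = "(*)"] arg_cong [where f = const])
       (auto simp: slice_tensor_def slice_def lookup_partial_deriv lookup_add
         lookup_single when_def add_ac)
  also have "\<dots> = const 6 * cubic_form n (slice_tensor n f)"
    by (simp add: cubic_form_def sum_triples sum_distrib_left const_mult mult_ac)
  finally have "const (1/6) * (const 6 * f) = const (1/6) * (const 6 * cubic_form n (slice_tensor n f))"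
    by simp
  then show ?thesis
    by (simp only: mult.assoc [symmetric] const_mult [symmetric]) simp
qed

text \<open>The third derivative of a product of three variables is a sum of Kronecker deltas over
  the six orderings of \<open>i\<close>, \<open>j\<close>, \<open>k\<close>. By symmetry of
  \<open>G\<close> all six contribute equally, which matches the division by 6 in
  \<open>slice\<close>.\<close>

lemma slice_tensor_cubic_form:
  assumes G: "symmetric_tensor n (G :: _ \<Rightarrow> _ \<Rightarrow> _ \<Rightarrow> 'a::field_char_0)"
    and ijk: "i < n" "j < n" "k < n"
  shows "slice_tensor n (cubic_form n G) i j k = G i j k"
proof -
  define \<delta> :: "nat \<Rightarrow> nat \<Rightarrow> 'a" where "\<delta> x y = (if x = y then 1 else 0)" for x y
  define \<Delta> where "\<Delta> = (\<lambda>(x, y, z) (a, b, c). \<delta> a x * (\<delta> b y * \<delta> c z))"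
  have at0: "Poly_Mapping.lookup (var a * p) 0 = 0" for a and p :: "'a mpoly"
  proof (induction p rule: mpoly_induct)
    case (single m c)
    have "Poly_Mapping.lookup (unit_exp a + m) a \<noteq> 0" by (simp add: lookup_add)
    then have "unit_exp a + m \<noteq> 0" by (metis lookup_zero)
    then show ?case by (simp add: var_def mult_single lookup_single)
  qed (simp add: distrib_left lookup_add)
  have d1: "partial_deriv i (1 :: 'a mpoly) = 0" for i
    using partial_deriv_single [of i 0 "1::'a"] by simp
  have dm: "partial_deriv i (var a * p) = const (\<delta> a i) * p + var a * partial_deriv i p" for i a and p :: "'a mpoly"
    by (auto simp: partial_deriv_var_mult \<delta>_def)
  have dv: "partial_deriv i (var a :: 'a mpoly) = const (\<delta> a i)" for i a
    using dm [of i a 1] by (simp add: d1)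
  have dc: "partial_deriv i (const c) = 0" for i and c :: 'a
    using partial_deriv_const_mult [of i c 1] by (simp add: d1)
  have L: "Poly_Mapping.lookup (partial_deriv i (partial_deriv j (partial_deriv k
      (var a * var b * (var c :: 'a mpoly))))) 0 =
      \<Delta> (i, j, k) (a, b, c) + \<Delta> (i, k, j) (a, b, c) + \<Delta> (j, i, k) (a, b, c)
      + \<Delta> (j, k, i) (a, b, c) + \<Delta> (k, i, j) (a, b, c) + \<Delta> (k, j, i) (a, b, c)" for a b c
    by (simp add: mult.assoc dm dv dc partial_deriv_add partial_deriv_const_mult lookup_add
        lookup_const_mult at0 \<Delta>_def distrib_left add_ac)
  have D: "(\<Sum>(a, b, c)\<in>triples n. G a b c * \<Delta> (x, y, z) (a, b, c)) = G x y z"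
    if "x < n" "y < n" "z < n" for x y z
  proof -
    have "(\<Sum>(a, b, c)\<in>triples n. G a b c * \<Delta> (x, y, z) (a, b, c))
        = (\<Sum>t\<in>triples n. if t = (x, y, z) then G x y z else 0)"
      by (intro sum.cong) (auto simp: \<Delta>_def \<delta>_def split: if_splits)
    with that show ?thesis by (simp add: triples_def)
  qed
  have "6 * slice_tensor n (cubic_form n G) i j k
      = (\<Sum>(a, b, c)\<in>triples n. G a b c * (\<Delta> (i, j, k) (a, b, c) + \<Delta> (i, k, j) (a, b, c)
          + \<Delta> (j, i, k) (a, b, c) + \<Delta> (j, k, i) (a, b, c) + \<Delta> (k, i, j) (a, b, c)
          + \<Delta> (k, j, i) (a, b, c)))"
    using ijk
    by (simp add: slice_tensor_def slice_def cubic_form_def partial_deriv_sum lookup_sum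
        case_prod_unfold partial_deriv_const_mult lookup_const_mult L)
  also have "\<dots> = G i j k + G i k j + G j i k + G j k i + G k i j + G k j i"
    using D [of i j k] D [of i k j] D [of j i k] D [of j k i] D [of k i j] D [of k j i] ijk
    by (simp add: distrib_left sum.distrib case_prod_unfold)
  also have "\<dots> = 6 * G i j k"
  proof -
    have "G i k j = G i j k" "G j i k = G i j k" "G j k i = G j i k" "G k i j = G i k j" "G k j i = G j k i"
      using G ijk unfolding symmetric_tensor_def by metis+
    then show ?thesis by simp
  qed
  finally show ?thesis by simp
qed

section \<open>Linear substitutions in cubic forms\<close>

lemma subst_vars_superset:
  assumes "finite K" "Poly_Mapping.keys p \<subseteq> K"
  shows "subst_vars s p = (\<Sum>m\<in>K. const (Poly_Mapping.lookup p m) *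
    (\<Prod>i\<in>Poly_Mapping.keys m. s i ^ Poly_Mapping.lookup m i))"
  unfolding subst_vars_def using assms
  by (intro sum.mono_neutral_left) (auto simp: not_in_keys_iff_lookup_eq_zero)

lemma subst_vars_add: "subst_vars s (p + q) = subst_vars s p + subst_vars s q"
proof -
  let ?K = "Poly_Mapping.keys p \<union> Poly_Mapping.keys q"
  have "Poly_Mapping.keys (p + q) \<subseteq> ?K" by (rule keys_add)
  then show ?thesis
    by (simp add: subst_vars_superset [of ?K] lookup_add const_add distrib_right sum.distrib)
qed

lemma subst_vars_zero [simp]: "subst_vars s 0 = 0"
  by (simp add: subst_vars_def)

lemma subst_vars_sum: "subst_vars s (sum f X) = (\<Sum>x\<in>X. subst_vars s (f x))"
  by (induction X rule: infinite_finite_induct) (simp_all add: subst_vars_add)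

text \<open>The indices may coincide, so the exponent vector is kept as a sum of three unit vectors,
  each of which contributes one factor to the product over the set of indices.\<close>

lemma subst_vars_cubic_monomial:
  "subst_vars s (const c * (var i * var j * var k)) = const c * (s i * s j * s k)"
proof -
  let ?m = "unit_exp i + unit_exp j + unit_exp k" and ?X = "{i, j, k}"
  have 1: "(\<Prod>l\<in>?X. s l ^ Poly_Mapping.lookup (unit_exp a) l) = s a" if "a \<in> ?X" for a
  proof -
    have "(\<Prod>l\<in>?X. s l ^ Poly_Mapping.lookup (unit_exp a) l) = (\<Prod>l\<in>?X. if l = a then s a else 1)"
      by (intro prod.cong) (auto simp: lookup_single when_def)
    then show ?thesis using that by (simp add: prod.delta)
  qed
  have "const c * (var i * var j * var k) = Poly_Mapping.single ?m c"
    by (simp add: const_def var_def mult_single)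
  moreover have "Poly_Mapping.keys ?m = ?X"
    by (auto simp: in_keys_iff lookup_add lookup_single when_def split: if_splits)
  moreover have "(\<Prod>l\<in>?X. s l ^ Poly_Mapping.lookup ?m l) = s i * s j * s k"
    unfolding lookup_add power_add prod.distrib using 1 by simp
  ultimately show ?thesis
    by (cases "c = 0") (simp_all add: subst_vars_def)
qed

lemma lin_subst_cubic_form:
  assumes R: "R \<in> carrier_mat n n"
  shows "lin_subst (cubic_form n G) R = cubic_form n (pullback n G R)"
proof -
  let ?l = "\<lambda>i. \<Sum>a<n. const (R $$ (i, a)) * var a"
  let ?M = "\<lambda>i j k a b c. const (G i j k * (R $$ (i, a) * R $$ (j, b) * R $$ (k, c))) * (var a * var b * var c)"
  have "lin_subst (cubic_form n G) R = (\<Sum>(i, j, k)\<in>triples n. const (G i j k) * (?l i * ?l j * ?l k))"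
    using R by (simp add: lin_subst_def cubic_form_def subst_vars_sum case_prod_unfold
        subst_vars_cubic_monomial)
  also have "\<dots> = (\<Sum>(i, j, k)\<in>triples n. \<Sum>(a, b, c)\<in>triples n. ?M i j k a b c)"
    unfolding product_sum_triples
    by (simp add: sum_distrib_left case_prod_unfold const_mult mult_ac)
  also have "\<dots> = (\<Sum>(a, b, c)\<in>triples n. \<Sum>(i, j, k)\<in>triples n. ?M i j k a b c)"
    unfolding case_prod_unfold by (rule sum.swap)
  also have "\<dots> = cubic_form n (pullback n G R)"
    by (simp add: cubic_form_def pullback_def const_sum sum_distrib_right case_prod_unfold)
  finally show ?thesis .
qed

lemma symmetric_pullback:
  assumes G: "symmetric_tensor n G"
  shows "symmetric_tensor n (pullback n G R)"
proof -
  have 1: "pullback n G R a b c = pullback n G R b a c" for a b c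
    unfolding pullback_def
    by (rule sum.reindex_bij_witness [of _ "\<lambda>(i, j, k). (j, i, k)" "\<lambda>(i, j, k). (j, i, k)"])
       (use G in \<open>auto simp: symmetric_tensor_def triples_def mult_ac\<close>)
  have 2: "pullback n G R a b c = pullback n G R a c b" for a b c
    unfolding pullback_def
    by (rule sum.reindex_bij_witness [of _ "\<lambda>(i, j, k). (i, k, j)" "\<lambda>(i, j, k). (i, k, j)"])
       (use G in \<open>auto simp: symmetric_tensor_def triples_def mult_ac\<close>)
  show ?thesis using 1 2 unfolding symmetric_tensor_def by blast
qed

section \<open>Tensors of sums of cubes of linear forms\<close>

definition cube_tensor :: "nat \<Rightarrow> 'a::comm_ring_1 mat \<Rightarrow> nat \<Rightarrow> nat \<Rightarrow> nat \<Rightarrow> 'a" where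
  "cube_tensor n B a b c = (\<Sum>s<n. B $$ (s, a) * B $$ (s, b) * B $$ (s, c))"

lemma symmetric_cube_tensor: "symmetric_tensor n (cube_tensor n B)"
  by (simp add: symmetric_tensor_def cube_tensor_def mult_ac)

text \<open>The form \<open>sum_cubes n\<close> has the diagonal tensor with entries 1, and its
  pullback by \<open>B\<close> is the tensor of the cubes of the rows of \<open>B\<close>.\<close>

lemma lin_subst_sum_cubes:
  assumes "B \<in> carrier_mat n n"
  shows "lin_subst (sum_cubes n) B = cubic_form n (cube_tensor n B)"
proof -
  let ?G = "\<lambda>i j k. if i = j \<and> j = k then 1 else 0 :: 'a"
  have "sum_cubes n = cubic_form n ?G"
    unfolding cubic_form_def sum_triples sum_cubes_def
  proof (rule sum.cong)
    fix i assume i: "i \<in> {..<n}"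
    have "const (?G i j k) * (var i * var j * var k)
      = (if k = i then if j = i then var i ^ 3 else 0 else (0 :: 'a mpoly))" for j k
      by (auto simp: power3_eq_cube)
    then have "(\<Sum>j<n. \<Sum>k<n. const (?G i j k) * (var i * var j * var k)) = var i ^ 3"
      using i by (simp only: sum.delta finite_lessThan if_True)
    then show "var i ^ 3 = (\<Sum>j<n. \<Sum>k<n. const (?G i j k) * (var i * var j * var k))"
      by (rule sym)
  qed simp
  moreover have "pullback n ?G B a b c = cube_tensor n B a b c" for a b c
  proof -
    have "?G i j k * (B $$ (i, a) * B $$ (j, b) * B $$ (k, c))
      = (if k = i then if j = i then B $$ (i, a) * B $$ (i, b) * B $$ (i, c) else 0 else 0)" for i j k
      by auto
    then show ?thesis
      unfolding pullback_def cube_tensor_def sum_triples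
      by (intro sum.cong refl) (simp only: sum.delta finite_lessThan if_True)
  qed
  ultimately show ?thesis
    using lin_subst_cubic_form [OF assms, of ?G] by (simp only: cong: cubic_form_cong)
qed

lemma pullback_cube_tensor:
  assumes A: "A \<in> carrier_mat n n" and R: "R \<in> carrier_mat n n" and "a < n" "b < n" "c < n"
  shows "pullback n (cube_tensor n A) R a b c = cube_tensor n (A * R) a b c"
proof -
  have "cube_tensor n (A * R) a b c = (\<Sum>s<n. (\<Sum>i<n. A $$ (s, i) * R $$ (i, a)) *
      (\<Sum>j<n. A $$ (s, j) * R $$ (j, b)) * (\<Sum>k<n. A $$ (s, k) * R $$ (k, c)))"
    unfolding cube_tensor_def using assms
    by (intro sum.cong) (simp_all add: times_mat_def scalar_prod_def atLeast0LessThan)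
  also have "\<dots> = (\<Sum>s<n. \<Sum>(i, j, k)\<in>triples n. A $$ (s, i) * A $$ (s, j) * A $$ (s, k) *
      (R $$ (i, a) * R $$ (j, b) * R $$ (k, c)))"
    unfolding product_sum_triples by (simp add: mult_ac)
  also have "\<dots> = pullback n (cube_tensor n A) R a b c"
    unfolding pullback_def cube_tensor_def
    by (subst sum.swap) (simp add: sum_distrib_right case_prod_unfold)
  finally show ?thesis by simp
qed

text \<open>Two successive pullbacks contract each index of \<open>G\<close> with
  \<open>R * S\<close>, here the identity.\<close>

lemma pullback_inverse:
  assumes R: "R \<in> carrier_mat n n" and S: "S \<in> carrier_mat n n" and RS: "R * S = 1\<^sub>m n"
    and "a < n" "b < n" "c < n"
  shows "pullback n (pullback n G R) S a b c = G a b c"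
proof -
  have e: "(\<Sum>a'<n. R $$ (i, a') * S $$ (a', a)) = (if i = a then 1 else 0)" if "i < n" "a < n" for i a
  proof -
    have "(R * S) $$ (i, a) = (if i = a then 1 else 0)" using RS that by simp
    then show ?thesis
      using R S that by (simp add: times_mat_def scalar_prod_def atLeast0LessThan)
  qed
  have "pullback n (pullback n G R) S a b c = (\<Sum>(i, j, k)\<in>triples n. G i j k *
     (\<Sum>(a', b', c')\<in>triples n. (R $$ (i, a') * S $$ (a', a)) * (R $$ (j, b') * S $$ (b', b)) *
        (R $$ (k, c') * S $$ (c', c))))"
    unfolding pullback_def
    by (simp add: sum_distrib_left sum_distrib_right case_prod_unfold) (subst sum.swap, simp add: mult_ac)
  also have "\<dots> = (\<Sum>(i, j, k)\<in>triples n. if (i, j, k) = (a, b, c) then G a b c else 0)"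
    unfolding product_sum_triples [symmetric] using assms
    by (intro sum.cong) (auto simp: e triples_def)
  also have "\<dots> = G a b c"
  proof -
    have "(\<Sum>(i, j, k)\<in>triples n. if (i, j, k) = (a, b, c) then G a b c else 0)
      = (\<Sum>t\<in>triples n. if t = (a, b, c) then G a b c else 0)"
      by (simp only: case_prod_unfold prod.collapse)
    then show ?thesis using assms by (simp add: triples_def)
  qed
  finally show ?thesis .
qed

section \<open>Accepted forms are sums of cubes\<close>

text \<open>\<open>mat_inverse\<close> returns \<open>None\<close> only outside the units of the
  matrix ring, which the inverse from the adjugate excludes.\<close>

lemma mat_inverse_exists:
  fixes A :: "'a::field mat"
  assumes A: "A \<in> carrier_mat n n" and det: "Determinant.det A \<noteq> 0"
  obtains B where "mat_inverse A = Some B" "B \<in> carrier_mat n n" "A * B = 1\<^sub>m n" "B * A = 1\<^sub>m n"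
proof -
  obtain C where "C \<in> carrier_mat n n" "A * C = 1\<^sub>m n" "C * A = 1\<^sub>m n"
    using inverse_if_det_nonzero [OF A det] .
  with A have "A \<in> Units (ring_mat TYPE('a) n ())"
    unfolding Units_def ring_mat_def by auto
  then obtain B where "mat_inverse A = Some B"
    using mat_inverse(1) [OF A, of "()"] by (cases "mat_inverse A") auto
  with mat_inverse(2) [OF A this] that show thesis by blast
qed

lemma slice_lin_subst:
  fixes G :: "nat \<Rightarrow> nat \<Rightarrow> nat \<Rightarrow> 'a::field_char_0"
  assumes "symmetric_tensor n G" "R \<in> carrier_mat n n" "k < n"
  shows "slice n (lin_subst (cubic_form n G) R) k = Matrix.mat n n (\<lambda>(i, j). pullback n G R k i j)"
proof (rule eq_matI)
  fix i j
  assume "i < dim_row (Matrix.mat n n (\<lambda>(i, j). pullback n G R k i j))"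
    "j < dim_col (Matrix.mat n n (\<lambda>(i, j). pullback n G R k i j))"
  then have ij: "i < n" "j < n" by auto
  have "slice n (lin_subst (cubic_form n G) R) k $$ (i, j) = slice_tensor n (cubic_form n (pullback n G R)) k i j"
    unfolding slice_tensor_def lin_subst_cubic_form [OF assms(2)] ..
  also have "\<dots> = pullback n G R k i j"
    using slice_tensor_cubic_form [OF symmetric_pullback [OF assms(1)] assms(3) ij] .
  finally show "slice n (lin_subst (cubic_form n G) R) k $$ (i, j)
      = Matrix.mat n n (\<lambda>(i, j). pullback n G R k i j) $$ (i, j)"
    using ij by simp
qed (simp_all add: slice_def)

text \<open>The row index of the slice occurs only in one factor from \<open>R\<close>, so the slice
  is the transpose of \<open>R\<close> times a matrix \<open>X\<close>, and the determinant is
  multiplicative.\<close>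

lemma det_nonzero_if_pullback_slice:
  fixes G :: "nat \<Rightarrow> nat \<Rightarrow> nat \<Rightarrow> 'a::field"
  assumes R: "R \<in> carrier_mat n n"
    and det: "Determinant.det (Matrix.mat n n (\<lambda>(i, j). pullback n G R k i j)) \<noteq> 0"
  shows "Determinant.det R \<noteq> 0"
proof -
  define X where "X = Matrix.mat n n (\<lambda>(b, j). \<Sum>a<n. \<Sum>c<n. G a b c * (R $$ (a, k) * R $$ (c, j)))"
  have X: "X \<in> carrier_mat n n" by (simp add: X_def)
  have RT: "transpose_mat R \<in> carrier_mat n n" using R by simp
  have "Matrix.mat n n (\<lambda>(i, j). pullback n G R k i j) = transpose_mat R * X"
  proof (rule eq_matI)
    fix i j assume "i < dim_row (transpose_mat R * X)" "j < dim_col (transpose_mat R * X)"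
    then have ij: "i < n" "j < n" using R X by auto
    have "(transpose_mat R * X) $$ (i, j)
        = (\<Sum>b<n. \<Sum>a<n. \<Sum>c<n. G a b c * (R $$ (a, k) * R $$ (b, i) * R $$ (c, j)))"
      unfolding index_mult_mat_sum [OF RT X ij] using R ij
      by (intro sum.cong) (auto simp: X_def sum_distrib_left mult_ac)
    also have "\<dots> = pullback n G R k i j"
      unfolding pullback_def sum_triples by (rule sum.swap)
    finally show "Matrix.mat n n (\<lambda>(i, j). pullback n G R k i j) $$ (i, j) = (transpose_mat R * X) $$ (i, j)"
      using ij by simp
  qed (use R X in auto)
  then show ?thesis
    using det det_mult [OF RT X] det_transpose [OF R] by auto
qed

lemma accepts_imp_equiv_sum_cubes:
  fixes f :: "'a::field_char_0 mpoly"
  assumes cube_root: "\<And>c :: 'a. \<exists>b. b ^ 3 = c" and n: "n \<ge> 1"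
    and f: "in_vars n f \<and> homogeneous 3 f" and R: "R \<in> carrier_mat n n" and acc: "accepts n f R"
  shows "equiv_sum_cubes n f"
proof -
  define G where "G = slice_tensor n f"
  define H where "H = pullback n G R"
  define T where "T k = Matrix.mat n n (\<lambda>(i, j). H k i j)" for k
  have G: "symmetric_tensor n G" by (simp add: G_def symmetric_slice_tensor)
  have fG: "f = cubic_form n G" using cubic_form_slice_tensor [OF f] by (simp add: G_def)
  have slice: "slice n (lin_subst f R) k = T k" if "k < n" for k
    unfolding fG T_def H_def by (rule slice_lin_subst [OF G R that])
  have T: "T k \<in> carrier_mat n n" for k by (simp add: T_def)
  from acc n slice have "invertible_mat (T 0)" by (simp add: accepts_def Let_def)
  then have det: "Determinant.det (T 0) \<noteq> 0" using invertible_mat_iff_det [OF T] by blast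
  obtain X where inv: "mat_inverse (T 0) = Some X" and X: "X \<in> carrier_mat n n" "X * T 0 = 1\<^sub>m n" "T 0 * X = 1\<^sub>m n"
    by (rule mat_inverse_exists [OF T det])
  have acc': "diagonalizable (X * T k)" "(X * T k) * (X * T l) = (X * T l) * (X * T k)"
    if "k \<in> {1..<n}" "l \<in> {1..<n}" for k l
    using acc n slice that inv by (auto simp: accepts_def Let_def)
  have sym: "H i j k = H j i k \<and> H i j k = H i k j" if "i < n" "j < n" "k < n" for i j k
    using symmetric_pullback [OF G, of R] that unfolding symmetric_tensor_def H_def by blast
  obtain Q Q' c where Q: "Q \<in> carrier_mat n n" and Q': "Q' \<in> carrier_mat n n" and QQ': "Q * Q' = 1\<^sub>m n"
    and c: "\<And>s. s < n \<Longrightarrow> c s \<noteq> 0"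
    and HQ: "\<And>i j k. i < n \<Longrightarrow> j < n \<Longrightarrow> k < n \<Longrightarrow>
      H i j k = (\<Sum>s<n. c s * (Q $$ (s, i) * Q $$ (s, j) * Q $$ (s, k)))"
    by (rule symmetric_slices_sum_of_cubes [OF n, of H X, folded T_def])
       (use sym X acc' in auto)
  obtain r where r: "\<And>s. r s ^ 3 = c s"
    using choice [of "\<lambda>s b. b ^ 3 = c s"] cube_root by blast
  have r0: "r s \<noteq> 0" if "s < n" for s using c [OF that] r [of s] by auto
  \<comment> \<open>Scaling row \<open>s\<close> of \<open>Q\<close> by a cube root of
    \<open>c s\<close> absorbs the coefficient into the cube.\<close>
  define B where "B = mat_diag n r * Q"
  define B' where "B' = Q' * mat_diag n (\<lambda>s. inverse (r s))"
  have B: "B \<in> carrier_mat n n" and B': "B' \<in> carrier_mat n n"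
    using Q Q' by (auto simp: B_def B'_def square_mult_carrier)
  have diag1: "mat_diag n (\<lambda>i. r i * inverse (r i)) = 1\<^sub>m n"
    using r0 by (intro eq_matI) (auto simp: mat_diag_def)
  have "B * B' = mat_diag n r * (Q * (Q' * mat_diag n (\<lambda>s. inverse (r s))))"
    unfolding B_def B'_def using Q Q'
    by (intro square_mult_assoc [of _ n]) (auto simp: square_mult_carrier)
  also have "\<dots> = 1\<^sub>m n"
    using inverse_mult_cancel [OF QQ' Q Q', of "mat_diag n (\<lambda>s. inverse (r s))"] diag1 by simp
  finally have BB': "B * B' = 1\<^sub>m n" .
  have HB: "H i j k = cube_tensor n B i j k" if "i < n" "j < n" "k < n" for i j k
    unfolding HQ [OF that] cube_tensor_def
  proof (rule sum.cong)
    fix s assume "s \<in> {..<n}"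
    with that have "B $$ (s, i) * B $$ (s, j) * B $$ (s, k) = r s ^ 3 * (Q $$ (s, i) * Q $$ (s, j) * Q $$ (s, k))"
      unfolding B_def mat_diag_mult_left [OF Q] by (simp add: power3_eq_cube mult_ac)
    then show "c s * (Q $$ (s, i) * Q $$ (s, j) * Q $$ (s, k)) = B $$ (s, i) * B $$ (s, j) * B $$ (s, k)"
      by (simp only: r)
  qed simp
  have detR: "Determinant.det R \<noteq> 0"
    using det_nonzero_if_pullback_slice [OF R] det unfolding T_def H_def .
  obtain S where S: "S \<in> carrier_mat n n" "R * S = 1\<^sub>m n" "S * R = 1\<^sub>m n"
    using inverse_if_det_nonzero [OF R detR] .
  have BS: "B * S \<in> carrier_mat n n" using B S(1) by (rule square_mult_carrier)
  \<comment> \<open>The form \<open>h\<close> has the tensor of the cubes of the rows of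
    \<open>B\<close>; undoing the substitution by \<open>R\<close> with its inverse \<open>S\<close>
    turns \<open>B\<close> into \<open>B * S\<close>.\<close>
  have "G a b e = cube_tensor n (B * S) a b e" if "a < n" "b < n" "e < n" for a b e
  proof -
    have "G a b e = pullback n H S a b e"
      unfolding H_def by (rule pullback_inverse [OF R S(1,2) that, symmetric])
    also have "\<dots> = pullback n (cube_tensor n B) S a b e"
      unfolding pullback_def by (intro sum.cong) (auto simp: HB triples_def)
    also have "\<dots> = cube_tensor n (B * S) a b e"
      by (rule pullback_cube_tensor [OF B S(1) that])
    finally show ?thesis .
  qed
  then have "f = lin_subst (sum_cubes n) (B * S)"
    unfolding fG lin_subst_sum_cubes [OF BS] by (rule cubic_form_cong)
  moreover have "invertible_mat (B * S)"
    unfolding invertible_mat_iff_det [OF BS] det_mult [OF B S(1)]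
    using det_nonzero_if_right_inverse [OF B B' BB'] det_nonzero_if_right_inverse [OF S(1) R S(3)] by simp
  ultimately show ?thesis
    using BS unfolding equiv_sum_cubes_def by blast
qed

section \<open>Sums of cubes are accepted\<close>

text \<open>The matrix \<open>B = A * R\<close> conjugates all products \<open>X * T k\<close> to
  diagonal matrices at once, so they commute and are diagonalizable.\<close>

lemma accepts_sum_cubes:
  fixes A :: "'a::field_char_0 mat"
  assumes n: "n \<ge> 1" and A: "A \<in> carrier_mat n n" and R: "R \<in> carrier_mat n n"
    and det: "Determinant.det (A * R) \<noteq> 0" and nz: "\<And>s. s < n \<Longrightarrow> (A * R) $$ (s, 0) \<noteq> 0"
  shows "accepts n (lin_subst (sum_cubes n) A) R"
proof -
  define B where "B = A * R"
  have B: "B \<in> carrier_mat n n" using A R by (simp add: B_def square_mult_carrier)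
  have BT: "transpose_mat B \<in> carrier_mat n n" using B by simp
  have detB: "Determinant.det B \<noteq> 0" using det by (simp add: B_def)
  have b0: "B $$ (s, 0) \<noteq> 0" if "s < n" for s using nz that by (simp add: B_def)
  define D where "D k = mat_diag n (\<lambda>s. B $$ (s, k))" for k
  \<comment> \<open>\<open>E k\<close> is the inverse of \<open>D 0\<close> times
    \<open>D k\<close>; the division is the reason for requiring a nonzero first column of
    \<open>A * R\<close>.\<close>
  define E where "E k = mat_diag n (\<lambda>s. B $$ (s, k) / B $$ (s, 0))" for k
  have D: "D k \<in> carrier_mat n n" and E: "E k \<in> carrier_mat n n" for k by (simp_all add: D_def E_def)
  define T where "T k = transpose_mat B * (D k * B)" for k
  have T: "T k \<in> carrier_mat n n" for k using BT D B by (simp add: T_def square_mult_carrier)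
  have slice: "slice n (lin_subst (lin_subst (sum_cubes n) A) R) k = T k" if "k < n" for k
    unfolding lin_subst_sum_cubes [OF A] slice_lin_subst [OF symmetric_cube_tensor R that]
  proof (rule eq_matI)
    fix i j assume "i < dim_row (T k)" "j < dim_col (T k)"
    then have ij: "i < n" "j < n" using T [of k] by auto
    have DB: "D k * B \<in> carrier_mat n n" using D B by (rule square_mult_carrier)
    have "pullback n (cube_tensor n A) R k i j = cube_tensor n B k i j"
      unfolding B_def by (rule pullback_cube_tensor [OF A R that ij])
    also have "\<dots> = T k $$ (i, j)"
      unfolding T_def cube_tensor_def index_mult_mat_sum [OF BT DB ij]
      unfolding D_def mat_diag_mult_left [OF B]
      using B ij by (intro sum.cong) (auto simp: mult_ac)
    finally show "Matrix.mat n n (\<lambda>(i, j). pullback n (cube_tensor n A) R k i j) $$ (i, j) = T k $$ (i, j)"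
      using ij by simp
  qed (use T [of k] in auto)
  obtain B' where B': "B' \<in> carrier_mat n n" "B * B' = 1\<^sub>m n" "B' * B = 1\<^sub>m n"
    using inverse_if_det_nonzero [OF B detB] .
  have "D 0 * mat_diag n (\<lambda>s. inverse (B $$ (s, 0))) = 1\<^sub>m n"
    unfolding D_def mat_diag_diag using b0 by (intro eq_matI) (auto simp: mat_diag_def)
  then have "Determinant.det (D 0) \<noteq> 0"
    by (rule det_nonzero_if_right_inverse [OF D mat_diag_dim])
  then have detT: "Determinant.det (T 0) \<noteq> 0"
    unfolding T_def det_mult [OF BT square_mult_carrier [OF D B]] det_mult [OF D B] det_transpose [OF B]
    using detB by simp
  obtain X where inv: "mat_inverse (T 0) = Some X" and X: "X \<in> carrier_mat n n" "X * T 0 = 1\<^sub>m n"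
    by (rule mat_inverse_exists [OF T detT])
  \<comment> \<open>Multiplying the right-hand side by \<open>T 0\<close> gives \<open>T k\<close>:
    the inner \<open>B * B'\<close> cancels and \<open>D 0 * E k = D k\<close>.\<close>
  have XT: "X * T k = B' * (E k * B)" for k
  proof -
    have DE: "D 0 * E k = D k"
      unfolding D_def E_def mat_diag_diag using b0 by (intro eq_matI) (auto simp: mat_diag_def)
    have "T 0 * (B' * (E k * B)) = transpose_mat B * (D 0 * (B * (B' * (E k * B))))"
      unfolding T_def using BT D [of 0] E [of k] B B'(1) by (simp add: square_simps)
    also have "\<dots> = transpose_mat B * (D 0 * E k * B)"
      unfolding inverse_mult_cancel [OF B'(2) B B'(1) square_mult_carrier [OF E B]]
        square_mult_assoc [OF D E B] ..
    finally have "T k = T 0 * (B' * (E k * B))" by (simp add: T_def DE)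
    then show ?thesis
      using inverse_mult_cancel [OF X(2,1) T square_mult_carrier [OF B'(1) square_mult_carrier [OF E B]]] by simp
  qed
  have prod: "(X * T k) * (X * T l) = B' * (E k * E l * B)" for k l
    unfolding XT using B B'(1) E [of k] E [of l] by (simp add: square_simps inverse_mult_cancel [OF B'(2)])
  have "E k * E l = E l * E k" for k l
    by (simp add: E_def mult.commute)
  then have "(X * T k) * (X * T l) = (X * T l) * (X * T k)" for k l
    unfolding prod by simp
  moreover have "diagonalizable (X * T k)" for k
  proof -
    have "similar_mat_wit (X * T k) (E k) B' B"
      unfolding similar_mat_wit_def Let_def XT using B B' E [of k]
      by (simp add: square_simps)
    moreover have "diagonal_mat (E k)" by (auto simp: diagonal_mat_def E_def mat_diag_def)
    ultimately show ?thesis unfolding diagonalizable_def similar_mat_def by blast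
  qed
  moreover have "invertible_mat (T 0)" using invertible_mat_iff_det [OF T] detT by blast
  ultimately show ?thesis
    using n slice inv by (auto simp: accepts_def Let_def)
qed

lemma prob_accepts_ge:
  fixes f :: "'a::field_char_0 mpoly"
  assumes n: "n \<ge> 1" and f: "equiv_sum_cubes n f" and S: "finite S" "S \<noteq> {}"
  shows "measure_pmf.prob (random_mat n S) {R. accepts n f R} \<ge> 1 - 2 * real n / real (card S)"
proof -
  let ?P = "Pi_pmf ({..<n} \<times> {..<n}) 0 (\<lambda>_. pmf_of_set S)"
  obtain A where A: "A \<in> carrier_mat n n" and inv: "invertible_mat A" and fA: "f = lin_subst (sum_cubes n) A"
    using f unfolding equiv_sum_cubes_def by blast
  have detA: "Determinant.det A \<noteq> 0" using inv invertible_mat_iff_det [OF A] by blast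
  define E where "E = {\<omega>. Determinant.det (Matrix.mat n n \<omega>) = (0 :: 'a)}"
  define F where "F s = {\<omega>. (A * Matrix.mat n n \<omega>) $$ (s, 0) = 0}" for s
  \<comment> \<open>Outside the bad events, \<open>A * R\<close> is invertible because both factors
    are, and its first column has no zero entry. The bad events \<open>E\<close> and all the
    \<open>F s\<close> together contribute at most \<open>n / card S\<close> each way.\<close>
  have "accepts n f (Matrix.mat n n \<omega>)" if "\<omega> \<notin> E \<union> (\<Union>s<n. F s)" for \<omega>
    unfolding fA
    by (rule accepts_sum_cubes [OF n A])
       (use that detA in \<open>auto simp: E_def F_def det_mult [OF A, of "Matrix.mat n n \<omega>"]\<close>)
  then have sub: "- (E \<union> (\<Union>s<n. F s)) \<subseteq> Matrix.mat n n -` {R. accepts n f R}" by auto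
  have "measure_pmf.prob ?P (E \<union> (\<Union>s<n. F s)) \<le> measure_pmf.prob ?P E + measure_pmf.prob ?P (\<Union>s<n. F s)"
    by (rule measure_Un_le) auto
  also have "measure_pmf.prob ?P (\<Union>s<n. F s) \<le> (\<Sum>s<n. measure_pmf.prob ?P (F s))"
    by (intro measure_pmf.finite_measure_subadditive_finite) auto
  also have "\<dots> \<le> (\<Sum>s<n. 1 / card S)"
    unfolding F_def by (intro sum_mono prob_entry_zero_le [OF S A detA]) simp
  also have "measure_pmf.prob ?P E \<le> n / card S"
    unfolding E_def by (rule prob_det_zero_le [OF S])
  finally have "measure_pmf.prob ?P (E \<union> (\<Union>s<n. F s)) \<le> 2 * real n / real (card S)" by simp
  then have "1 - 2 * real n / real (card S) \<le> measure_pmf.prob ?P (- (E \<union> (\<Union>s<n. F s)))"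
    by (subst measure_pmf.prob_compl [of "E \<union> (\<Union>s<n. F s)", simplified, unfolded Compl_eq_Diff_UNIV [symmetric]]) auto
  also have "\<dots> \<le> measure_pmf.prob ?P (Matrix.mat n n -` {R. accepts n f R})"
    using sub by (intro measure_pmf.finite_measure_mono) auto
  also have "\<dots> = measure_pmf.prob (random_mat n S) {R. accepts n f R}"
    by (simp add: random_mat_def)
  finally show ?thesis .
qed

lemma complex_cube_root: "\<exists>b :: complex. b ^ 3 = c"
proof (cases "c = 0")
  case False
  have "exp (Ln c / 3) ^ 3 = exp (of_nat 3 * (Ln c / 3))" by (rule exp_of_nat_mult [symmetric])
  with False have "exp (Ln c / 3) ^ 3 = c" by simp
  then show ?thesis ..
qed (auto intro: exI [of _ 0])

lemma real_cube_root: "\<exists>b :: real. b ^ 3 = c"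
  using odd_real_root_pow [of 3 c] by auto

text \<open>Phrased for any field of characteristic 0 with cube roots, so that the real and the
  complex case are two instances.\<close>

lemma procedure_correct:
  fixes f :: "'a::field_char_0 mpoly"
  assumes "n \<ge> 1" and "\<And>c :: 'a. \<exists>b. b ^ 3 = c"
  shows "in_vars n f \<and> homogeneous 3 f \<longrightarrow>
    ((\<exists>R \<in> carrier_mat n n. accepts n f R) \<longrightarrow> equiv_sum_cubes n f) \<and>
    (equiv_sum_cubes n f \<longrightarrow>
      (\<forall>S. finite S \<and> S \<noteq> {} \<longrightarrow>
         measure_pmf.prob (random_mat n S) {R. accepts n f R}
           \<ge> 1 - 2 * real n / real (card S)))"
  using accepts_imp_equiv_sum_cubes [OF assms(2,1)] prob_accepts_ge [OF assms(1)] by blast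

theorem theorem4p2:
  fixes n :: nat
  assumes "n \<ge> 1"
  shows
    "(\<forall>f :: real mpoly. in_vars n f \<and> homogeneous 3 f \<longrightarrow>
        ((\<exists>R \<in> carrier_mat n n. accepts n f R) \<longrightarrow> equiv_sum_cubes n f) \<and>
        (equiv_sum_cubes n f \<longrightarrow>
          (\<forall>S :: real set. finite S \<and> S \<noteq> {} \<longrightarrow>
             measure_pmf.prob (random_mat n S) {R. accepts n f R}
               \<ge> 1 - 2 * real n / real (card S)))) \<and>
     (\<forall>f :: complex mpoly. in_vars n f \<and> homogeneous 3 f \<longrightarrow>
        ((\<exists>R \<in> carrier_mat n n. accepts n f R) \<longrightarrow> equiv_sum_cubes n f) \<and>
        (equiv_sum_cubes n f \<longrightarrow>
          (\<forall>S :: complex set. finite S \<and> S \<noteq> {} \<longrightarrow>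
             measure_pmf.prob (random_mat n S) {R. accepts n f R}
               \<ge> 1 - 2 * real n / real (card S))))"
  by (intro conjI allI procedure_correct assms real_cube_root complex_cube_root)

end
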